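(* Let $g:[0,\infty)\to(0,\infty)$ be monotonically increasing with $1/g$ bounded, and let $g_0=g$, $g_n(t)=\int_0^t g_{n-1}(t')\,dt'$ for $n\in\mathbb{N}$. Then the operators $A_0,A_1,A_2,A_{12}$ (defined below on $\mathcal{S}$) satisfy, with all suprema over $\psi\in\mathcal{S}\setminus\{0\}$ and $t\ge 0$: \begin{align*} \sup_{\psi} \frac{\| A_0 \psi \|_g}{\| \psi \|_g} &\leq \frac{\lambda}{8\pi} \Big(\sup_{t} \frac{g_1(t)}{g(t)}\Big)^2,\\ \sup_{\psi} \frac{\| A_1 \psi \|_g}{\| \psi \|_g} &\leq \frac{\lambda m_1^2}{16\pi} \Big[ 3\Big(\sup_{t}\tfrac{t g_1(t)}{g(t)}\Big)\Big(\sup_{t}\tfrac{g_2(t)}{g(t)}\Big) + 3\Big( \sup_{t} \tfrac{g_1(t)}{g(t)} \Big)\Big( \sup_{t} \tfrac{tg_2(t)}{g(t)} \Big) + 2 \Big( \sup_{t} \tfrac{g_1(t)}{g(t)} \Big)\Big( \sup_{t} \tfrac{g_3(t)}{g(t)} \Big) \Big],\\ \sup_{\psi} \frac{\| A_2 \psi \|_g}{\| \psi \|_g} &\leq \frac{\lambda m_2^2}{16\pi} \Big[ 3\Big(\sup_{t}\tfrac{t g_1(t)}{g(t)}\Big)\Big(\sup_{t}\tfrac{g_2(t)}{g(t)}\Big) + 3\Big( \sup_{t} \tfrac{g_1(t)}{g(t)} \Big)\Big( \sup_{t} \tfrac{tg_2(t)}{g(t)} \Big) + 2 \Big( \sup_{t}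 \tfrac{g_1(t)}{g(t)} \Big)\Big( \sup_{t} \tfrac{g_3(t)}{g(t)} \Big) \Big],\\ \sup_{\psi} \frac{\| A_{12} \psi \|_g}{\| \psi \|_g} &\leq \frac{\lambda m_1^2 m_2^2}{96\pi} \Big[ \Big( \sup_{t} \tfrac{t^2 g_2(t)}{g(t)}\Big)\Big( \sup_{t} \tfrac{t g_1(t)}{g(t)}\Big) + \tfrac{1}{2} \Big( \sup_{t} \tfrac{t^2 g_3(t)}{g(t)}\Big)\Big( \sup_{t} \tfrac{g_1(t)}{g(t)}\Big) \Big]. \end{align*}
   Context: Let $\tfrac12\mathbb{M}=[0,\infty)\times\mathbb{R}^3$ with points $x=(x^0,\mathbf{x})$, and Minkowski square $x^2=(x^0)^2-|\mathbf{x}|^2$. Fix $\lambda>0$ and masses $m_1,m_2\ge 0$. Let $\mathcal{S}=\mathcal{S}((\tfrac12\mathbb{M})^2)$ be the Schwartz functions on $(\tfrac12\mathbb{M})^2$. For $g$ as in the claim, $\|\psi\|_g=\operatorname{ess\,sup}_{x,y\in\frac12\mathbb{M}}|\psi(x,y)|/(g(x^0)g(y^0))$. $H$ is the Heaviside function, $J_1$ the Bessel function of the first kind, $1_{\{\cdot\}}$ an indicator function, $dS(\omega)$ the surface measure on the unit sphere $S^2$. The operators are the rigorous versions, on test functions, of the formal operator $\psi\mapsto \frac{\lambda}{4\pi}\int d^4x'\,d^4y'\,G_1^{\rm ret}(x-x')G_2^{\rm ret}(y-y')\delta((x'-y')^2)\psi(x',y')$ over $(\frac12\mathbb M)^2$,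 where $G_k^{\rm ret}(x)=\frac{\delta(x^0-|\mathbf{x}|)}{4\pi|\mathbf{x}|}-\frac{m_k}{4\pi}H(x^0-|\mathbf{x}|)\frac{J_1(m_k\sqrt{x^2})}{\sqrt{x^2}}$; explicitly, for $\psi\in\mathcal{S}$ and $x,y\in\frac12\mathbb{M}$: $A_0$: for $\mathbf{y}'\in\mathbb{R}^3$ with $|\mathbf{y}'|<y^0$ set $b^0=x^0-y^0+|\mathbf{y}'|$, $\mathbf{b}=\mathbf{x}-\mathbf{y}-\mathbf{y}'$, $b^2=(b^0)^2-|\mathbf{b}|^2$; for $\omega\in S^2$ let $\cos\vartheta=\omega\cdot\mathbf{b}/|\mathbf{b}|$ and $r^*=\frac{b^2}{2(b^0+|\mathbf{b}|\cos\vartheta)}$. Then $(A_0\psi)(x,y)=\frac{\lambda}{(4\pi)^3}\int_{|\mathbf{y}'|<y^0}d^3\mathbf{y}'\int_{S^2}dS(\omega)\,\frac{|b^2|}{4(b^0+|\mathbf{b}|\cos\vartheta)^2|\mathbf{y}'|}\,\psi(x^0-r^*,\mathbf{x}+r^*\omega,\,y^0-|\mathbf{y}'|,\mathbf{y}+\mathbf{y}')\Big(1_{b^2>0}1_{b^0>0}1_{\cos\vartheta>\frac{b^2}{2x^0|\mathbf{b}|}-\frac{b^0}{|\mathbf{b}|}}+1_{b^2<0}1_{\cos\vartheta<\frac{b^2}{2x^0|\mathbf{b}|}-\frac{b^0}{|\mathbf{b}|}}\Big)$. $A_1$: $(A_1\psi)(x,y)=-\frac{\lambda m_1}{2(4\pi)^3}\int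 d^3\mathbf{x}'\int d^3\mathbf{y}'\,\frac{H(y^0-|\mathbf{y}-\mathbf{y}'|)}{|\mathbf{y}-\mathbf{y}'|\,|\mathbf{x}'-\mathbf{y}'|}\sum_{\sigma=\pm1}\Big[H(x'^0)H(x^0-x'^0-|\mathbf{x}-\mathbf{x}'|)\frac{J_1(m_1\sqrt{(x-x')^2})}{\sqrt{(x-x')^2}}\psi(x',y')\Big]$ where $y'^0=y^0-|\mathbf{y}-\mathbf{y}'|$ and $x'^0=y'^0+\sigma|\mathbf{x}'-\mathbf{y}'|$. $A_2$: the same with the roles of the two particles exchanged: $(A_2\psi)(x,y)=-\frac{\lambda m_2}{2(4\pi)^3}\int d^3\mathbf{x}'\int d^3\mathbf{y}'\,\frac{H(x^0-|\mathbf{x}-\mathbf{x}'|)}{|\mathbf{x}-\mathbf{x}'|\,|\mathbf{x}'-\mathbf{y}'|}\sum_{\sigma=\pm1}\Big[H(y'^0)H(y^0-y'^0-|\mathbf{y}-\mathbf{y}'|)\frac{J_1(m_2\sqrt{(y-y')^2})}{\sqrt{(y-y')^2}}\psi(x',y')\Big]$ where $x'^0=x^0-|\mathbf{x}-\mathbf{x}'|$, $y'^0=x'^0+\sigma|\mathbf{x}'-\mathbf{y}'|$. $A_{12}$: $(A_{12}\psi)(x,y)=\frac{\lambda m_1m_2}{2(4\pi)^3}\int_0^\infty dx'^0\int d^3\mathbf{x}'\int_0^\infty dy'^0\int_{S^2}dS(\omega)\,|x'^0-y'^0|\,H(x^0-x'^0-|\mathbf{x}-\mathbf{x}'|)\frac{J_1(m_1\sqrt{(x-x')^2})}{\sqrt{(x-x')^2}}H(y^0-y'^0-|\mathbf{y}-\mathbf{y}'|)\frac{J_1(m_2\sqrt{(y-y')^2})}{\sqrt{(y-y')^2}}\psi(x',y')$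 with $\mathbf{y}'=\mathbf{x}'-|x'^0-y'^0|\,\omega$. *)

theory Defs
  imports "HOL-Probability.Probability"
begin

text \<open>Points of Minkowski space: (time component, spatial 3-vector).\<close>
type_synonym mpoint = "real \<times> (real^3)"

definition halfM :: "mpoint set" where
  "halfM = {x. fst x \<ge> 0}"

definition msq :: "mpoint \<Rightarrow> real" where
  "msq x = (fst x)^2 - (norm (snd x))^2"

definition heaviside :: "real \<Rightarrow> real" where
  "heaviside t = (if 0 \<le> t then 1 else 0)"

definition besselJ1 :: "real \<Rightarrow> real" where
  "besselJ1 x = (\<Sum>k. (-1)^k / (fact k * fact (k+1)) * (x/2)^(2*k+1))"

definition sphpt :: "real \<Rightarrow> real \<Rightarrow> real^3" where
  "sphpt th ph = (\<chi> i. if i = 1 then sin th * cos ph else if i = 2 then sin th * sin ph else cos th)"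

definition sphere_integral :: "(real^3 \<Rightarrow> complex) \<Rightarrow> complex" where
  "sphere_integral f =
     set_lebesgue_integral lborel {0..pi} (\<lambda>th.
       set_lebesgue_integral lborel {0..2*pi} (\<lambda>ph. complex_of_real (sin th) * f (sphpt th ph)))"

fun iter_dd :: "'a::real_normed_vector list \<Rightarrow> ('a \<Rightarrow> 'b::real_normed_vector) \<Rightarrow> 'a \<Rightarrow> 'b" where
  "iter_dd [] f = f"
| "iter_dd (v # vs) f = (\<lambda>x. frechet_derivative (iter_dd vs f) (at x) v)"

definition schwartz :: "('a::euclidean_space \<Rightarrow> complex) \<Rightarrow> bool" where
  "schwartz f \<longleftrightarrow>
     (\<forall>vs x. iter_dd vs f differentiable (at x)) \<and>
     (\<forall>vs (k::nat). bdd_above (range (\<lambda>x. (1 + norm x)^k * norm (iter_dd vs f x))))"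

text \<open>Schwartz functions on (1/2 M)^2: restrictions of Schwartz functions on R^8,
  represented as functions that vanish outside (1/2 M)^2.\<close>
definition schwartz_half :: "(mpoint \<Rightarrow> mpoint \<Rightarrow> complex) set" where
  "schwartz_half = {\<psi>. (\<exists>\<Psi>. schwartz \<Psi> \<and> (\<forall>x y. x \<in> halfM \<longrightarrow> y \<in> halfM \<longrightarrow> \<psi> x y = \<Psi> (x, y)))
                         \<and> (\<forall>x y. \<not> (x \<in> halfM \<and> y \<in> halfM) \<longrightarrow> \<psi> x y = 0)}"

definition gnorm :: "(real \<Rightarrow> real) \<Rightarrow> (mpoint \<Rightarrow> mpoint \<Rightarrow> complex) \<Rightarrow> ereal" where
  "gnorm g \<psi> = esssup (restrict_space lborel (halfM \<times> halfM))
      (\<lambda>(x, y). ereal (cmod (\<psi> x y) / (g (fst x) * g (fst y))))"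

fun giter :: "(real \<Rightarrow> real) \<Rightarrow> nat \<Rightarrow> real \<Rightarrow> real" where
  "giter g 0 = g"
| "giter g (Suc n) = (\<lambda>t. integral {0..t} (giter g n))"

definition opA0 :: "real \<Rightarrow> (mpoint \<Rightarrow> mpoint \<Rightarrow> complex) \<Rightarrow> mpoint \<Rightarrow> mpoint \<Rightarrow> complex" where
  "opA0 lam \<psi> x y =
    complex_of_real (lam / (4*pi)^3) *
    set_lebesgue_integral lborel (ball 0 (fst y)) (\<lambda>yp.
      sphere_integral (\<lambda>\<omega>.
        let b0 = fst x - fst y + norm yp;
            bv = snd x - snd y - yp;
            b2 = b0^2 - (norm bv)^2;
            c = (\<omega> \<bullet> bv) / norm bv;
            D = b0 + norm bv * c;
            r = b2 / (2 * D);
            thr = b2 / (2 * fst x * norm bv) - b0 / norm bv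
        in complex_of_real (\<bar>b2\<bar> / (4 * D^2 * norm yp) *
             ((if b2 > 0 \<and> b0 > 0 \<and> c > thr then 1 else 0)
              + (if b2 < 0 \<and> c < thr then 1 else 0)))
           * \<psi> (fst x - r, snd x + r *\<^sub>R \<omega>) (fst y - norm yp, snd y + yp)))"

definition opA1 :: "real \<Rightarrow> real \<Rightarrow> (mpoint \<Rightarrow> mpoint \<Rightarrow> complex) \<Rightarrow> mpoint \<Rightarrow> mpoint \<Rightarrow> complex" where
  "opA1 lam m1 \<psi> x y =
    complex_of_real (- lam * m1 / (2 * (4*pi)^3)) *
    integral\<^sup>L lborel (\<lambda>xp. integral\<^sup>L lborel (\<lambda>yp.
      let y0' = fst y - norm (snd y - yp)
      in complex_of_real (heaviside (fst y - norm (snd y - yp)) / (norm (snd y - yp) * norm (xp - yp))) *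
         (\<Sum>\<sigma>\<in>{-1, 1::real}.
            let x0' = y0' + \<sigma> * norm (xp - yp);
                s = sqrt (msq (fst x - x0', snd x - xp))
            in complex_of_real (heaviside x0' * heaviside (fst x - x0' - norm (snd x - xp))
                  * besselJ1 (m1 * s) / s) * \<psi> (x0', xp) (y0', yp))))"

definition opA2 :: "real \<Rightarrow> real \<Rightarrow> (mpoint \<Rightarrow> mpoint \<Rightarrow> complex) \<Rightarrow> mpoint \<Rightarrow> mpoint \<Rightarrow> complex" where
  "opA2 lam m2 \<psi> x y =
    complex_of_real (- lam * m2 / (2 * (4*pi)^3)) *
    integral\<^sup>L lborel (\<lambda>xp. integral\<^sup>L lborel (\<lambda>yp.
      let x0' = fst x - norm (snd x - xp)
      in complex_of_real (heaviside (fst x - norm (snd x - xp)) / (norm (snd x - xp) * norm (xp - yp))) *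
         (\<Sum>\<sigma>\<in>{-1, 1::real}.
            let y0' = x0' + \<sigma> * norm (xp - yp);
                s = sqrt (msq (fst y - y0', snd y - yp))
            in complex_of_real (heaviside y0' * heaviside (fst y - y0' - norm (snd y - yp))
                  * besselJ1 (m2 * s) / s) * \<psi> (x0', xp) (y0', yp))))"

definition opA12 :: "real \<Rightarrow> real \<Rightarrow> real \<Rightarrow> (mpoint \<Rightarrow> mpoint \<Rightarrow> complex) \<Rightarrow> mpoint \<Rightarrow> mpoint \<Rightarrow> complex" where
  "opA12 lam m1 m2 \<psi> x y =
    complex_of_real (lam * m1 * m2 / (2 * (4*pi)^3)) *
    set_lebesgue_integral lborel {0..} (\<lambda>x0'.
     integral\<^sup>L lborel (\<lambda>xp.
      set_lebesgue_integral lborel {0..} (\<lambda>y0'.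
       sphere_integral (\<lambda>\<omega>.
        let yp = xp - \<bar>x0' - y0'\<bar> *\<^sub>R \<omega>;
            s1 = sqrt (msq (fst x - x0', snd x - xp));
            s2 = sqrt (msq (fst y - y0', snd y - yp))
        in complex_of_real (\<bar>x0' - y0'\<bar>
              * heaviside (fst x - x0' - norm (snd x - xp)) * besselJ1 (m1 * s1) / s1
              * heaviside (fst y - y0' - norm (snd y - yp)) * besselJ1 (m2 * s2) / s2)
           * \<psi> (x0', xp) (y0', yp)))))"

definition tsup :: "(real \<Rightarrow> real) \<Rightarrow> ereal" where
  "tsup f = (SUP t\<in>{0..}. ereal (f t))"

definition opsup :: "(real \<Rightarrow> real) \<Rightarrow> ((mpoint \<Rightarrow> mpoint \<Rightarrow> complex) \<Rightarrow> mpoint \<Rightarrow> mpoint \<Rightarrow> complex) \<Rightarrow> ereal" where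
  "opsup g A = (SUP \<psi>\<in>schwartz_half - {\<lambda>_ _. 0}. gnorm g (A \<psi>) / gnorm g \<psi>)"

end

theory Submission
  imports Defs
begin

text \<open>
  All four operators are dominated by integrals of nonnegative kernels, so it suffices to replace
  \<open>|\<psi>|\<close> by \<open>\<nu> G(x\<^sup>0) G(y\<^sup>0)\<close> with \<open>\<nu>\<close> the weighted norm of \<open>\<psi>\<close>. Continuity of \<open>\<psi>\<close> and
  monotonicity of \<open>g\<close> upgrade the essential bound to a pointwise one, which is needed because the
  kernels live on null sets; here \<open>G\<close> is \<open>g\<close> with its value at \<open>0\<close> replaced by the right limit.

  For \<open>A\<^sub>0\<close>, the angular integral depends on \<open>\<omega>\<close> only through \<open>u = cos \<vartheta>\<close>, so by Archimedes' hat-box theorem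
  it is \<open>2\<pi>\<close> times an integral over \<open>[-1, 1]\<close>; the substitution \<open>r = b\<^sup>2 / (2 (b\<^sup>0 + |b| u))\<close> bounds it by
  \<open>\<pi> g\<^sub>1(x\<^sup>0) / |b|\<close>. Since \<open>h(s) = G(y\<^sup>0 - s)\<close> is decreasing,
  \<open>h(|z|) / (|z| |a - z|) \<le> h(|z|) / |z|\<^sup>2 + h(|a - z|) / |a - z|\<^sup>2\<close>, and both terms integrate to at most \<open>4\<pi> g\<^sub>1(y\<^sup>0)\<close>.

  For the massive operators, \<open>|J\<^sub>1(m s) / s| \<le> m / 2\<close>; of each remaining light cone constraint one keeps
  only the bound on the time coordinate (and, for \<open>x'\<close> in \<open>A\<^sub>1\<^sub>2\<close>, the volume of the ball), and evaluates in
  polar coordinates. The iterated integrals are \<open>n! g\<^bsub>n+1\<^esub>(t) = \<integral> (t - u)\<^sup>n G(u) du\<close>.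
\<close>

section \<open>A bound on the Bessel function\<close>

text \<open>The integrals are estimated in \<open>ennreal\<close>: a nonintegrable function has
  Bochner integral 0, so the norm of an operator value is always at most the nonnegative integral of
  the norm of its integrand. The obstacle in \<open>A0\<close> is that the axis b varies with y',
  while \<open>sphere_integral\<close> is tied to fixed polar coordinates. Rotation invariance is
  proved by differentiating in the tilt angle of the axis, and carried from smooth to measurable
  integrands by characteristic functions. With X = x^0 and Y = y^0, \<open>A1\<close> has the
  majorant (X + Y) g1(X) g2(Y), that is, coefficients 1, 1, 0 to be compared with 3, 3, 2; for
  \<open>A2\<close> the times are exchanged. The majorant of \<open>A12\<close> is X^2 Y g2(X) g1(Y)
  + (1/2) X^2 g3(X) g1(Y), where 1/2 is 2!/4 and the 4 comes from u (X - u) \<le> X^2 / 4.\<close>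

definition J1_coeff :: "nat \<Rightarrow> real" where
  "J1_coeff k = (-1) ^ k / (fact k * fact (k + 1) * 2 ^ (2 * k + 1))"

definition J1_series :: "real \<Rightarrow> real" where
  "J1_series z = (\<Sum>k. J1_coeff k * z ^ k)"

lemma summable_J1_coeff: "summable (\<lambda>k. J1_coeff k * z ^ k)"
proof (rule summable_comparison_test'[OF summable_norm_exp[of z]])
  fix k :: nat
  have "(1::real) \<le> fact (k + 1) * 2 ^ (2 * k + 1)"
    by (metis fact_ge_1 mult_ge1_I one_le_numeral one_le_power)
  then have "norm (J1_coeff k) \<le> inverse (fact k)"
    by (simp add: J1_coeff_def power_abs divide_simps mult.assoc mult_le_cancel_left1 del: fact_Suc)
  then show "norm (J1_coeff k * z ^ k) \<le> norm (z ^ k /\<^sub>R fact k)"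
    by (simp add: abs_mult mult_right_mono)
qed

text \<open>The coefficient of z^k in 4 z F'' + 8 F' + F is 4 (k + 1) k c(k+1) + 8 (k + 1) c(k+1) +
  c(k); the recursion sets it to zero.\<close>

lemma J1_coeff_rec: "4 * (real k + 1) * (real k + 2) * J1_coeff (Suc k) = - J1_coeff k"
  by (simp add: J1_coeff_def divide_simps) (simp add: algebra_simps)

lemma besselJ1_eq: "besselJ1 x = x * J1_series (x\<^sup>2)"
proof -
  have "(-1) ^ k / (fact k * fact (k + 1)) * (x / 2) ^ (2 * k + 1) = x * (J1_coeff k * (x\<^sup>2) ^ k)" for k
    by (simp add: J1_coeff_def power_divide power_mult)
  then show ?thesis
    unfolding besselJ1_def J1_series_def using suminf_mult[OF summable_J1_coeff, of x "x\<^sup>2"] by simp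
qed

text \<open>The function \<open>J1_series\<close> solves \<open>4 z F'' + 8 F' + F = 0\<close>, so \<open>F\<^sup>2 + 4 z F'\<^sup>2\<close> is
  nonincreasing for \<open>z \<ge> 0\<close>.\<close>

lemma abs_J1_series_le:
  assumes "z \<ge> 0" shows "\<bar>J1_series z\<bar> \<le> 1 / 2"
proof -
  define F' where "F' = (\<lambda>z. \<Sum>k. diffs J1_coeff k * z ^ k)"
  define F'' where "F'' = (\<lambda>z. \<Sum>k. diffs (diffs J1_coeff) k * z ^ k)"
  have s1: "summable (\<lambda>k. diffs J1_coeff k * y ^ k)" for y
    by (rule termdiff_converges_all) (rule summable_J1_coeff)
  have s2: "summable (\<lambda>k. diffs (diffs J1_coeff) k * y ^ k)" for y
    by (rule termdiff_converges_all) (rule s1)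
  have F: "(J1_series has_real_derivative F' y) (at y)" for y
    unfolding J1_series_def F'_def
    by (rule termdiffs_strong_converges_everywhere) (rule summable_J1_coeff)
  have F': "(F' has_real_derivative F'' y) (at y)" for y
    unfolding F'_def F''_def
    by (rule termdiffs_strong_converges_everywhere) (rule s1)
  have ode: "4 * y * F'' y + 8 * F' y + J1_series y = 0" for y
  proof -
    have "(\<lambda>k. y * (diffs (diffs J1_coeff) k * y ^ k)) sums (y * F'' y)"
      unfolding F''_def by (intro sums_mult summable_sums s2)
    then have "(\<lambda>k. real (Suc k) * diffs J1_coeff (Suc k) * y ^ Suc k) sums (y * F'' y)"
      by (simp add: diffs_def mult_ac)
    then have a: "(\<lambda>k. real k * diffs J1_coeff k * y ^ k) sums (y * F'' y)"
      using sums_Suc_iff[of "\<lambda>k. real k * diffs J1_coeff k * y ^ k" "y * F'' y"] by simp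
    have b: "(\<lambda>k. diffs J1_coeff k * y ^ k) sums F' y"
      unfolding F'_def by (intro summable_sums s1)
    have c: "(\<lambda>k. J1_coeff k * y ^ k) sums J1_series y"
      unfolding J1_series_def by (intro summable_sums summable_J1_coeff)
    have "(\<lambda>k. 4 * (real k * diffs J1_coeff k * y ^ k) + 8 * (diffs J1_coeff k * y ^ k) + J1_coeff k * y ^ k)
        sums (4 * (y * F'' y) + 8 * F' y + J1_series y)"
      by (intro sums_add sums_mult a b c)
    moreover have "4 * (real k * diffs J1_coeff k * y ^ k) + 8 * (diffs J1_coeff k * y ^ k) + J1_coeff k * y ^ k = 0" for k
    proof -
      have "4 * (real k * diffs J1_coeff k * y ^ k) + 8 * (diffs J1_coeff k * y ^ k) + J1_coeff k * y ^ k
         = (4 * (real k + 1) * (real k + 2) * J1_coeff (Suc k) + J1_coeff k) * y ^ k"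
        by (simp add: diffs_def algebra_simps)
      then show ?thesis by (simp only: J1_coeff_rec) simp
    qed
    ultimately have "(\<lambda>k::nat. 0) sums (4 * (y * F'' y) + 8 * F' y + J1_series y)" by simp
    then show ?thesis by (metis mult.assoc sums_unique2 sums_zero)
  qed
  define E where "E = (\<lambda>y. (J1_series y)\<^sup>2 + 4 * y * (F' y)\<^sup>2)"
  have "E z \<le> E 0"
  proof (rule DERIV_nonpos_imp_nonincreasing[OF assms])
    fix y :: real
    have "(E has_real_derivative 2 * J1_series y * F' y + (4 * (F' y)\<^sup>2 + 4 * y * (2 * F' y * F'' y))) (at y)"
      unfolding E_def by (auto intro!: derivative_eq_intros F F' simp: power2_eq_square algebra_simps)
    \<comment> \<open>Completing the differential equation absorbs 16 F'^2, which turns the 4 F'^2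
      from differentiating the factor 4 y into -12 F'^2.\<close>
    moreover have "2 * J1_series y * F' y + (4 * (F' y)\<^sup>2 + 4 * y * (2 * F' y * F'' y))
        = 2 * F' y * (4 * y * F'' y + 8 * F' y + J1_series y) - 12 * (F' y)\<^sup>2"
      by (simp add: power2_eq_square algebra_simps)
    ultimately show "\<exists>d. (E has_real_derivative d) (at y) \<and> d \<le> 0"
      by (metis ode diff_le_0_iff_le mult_zero_right zero_le_numeral zero_le_power2 zero_le_mult_iff)
  qed
  moreover have "J1_series 0 = 1 / 2"
    unfolding J1_series_def by (subst suminf_finite[of "{0}"]) (auto simp: J1_coeff_def)
  ultimately have "(J1_series z)\<^sup>2 + 4 * z * (F' z)\<^sup>2 \<le> (1 / 2)\<^sup>2"
    by (simp add: E_def)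
  moreover have "4 * z * (F' z)\<^sup>2 \<ge> 0" using assms by simp
  ultimately have "(J1_series z)\<^sup>2 \<le> (1 / 2)\<^sup>2" by linarith
  then show ?thesis by (metis abs_le_square_iff abs_of_pos half_gt_zero_iff zero_less_one)
qed

text \<open>No sign condition on \<open>s\<close>: the series is evaluated at (m s)^2. At s = 0 the
  quotient is 0 by convention, and the square root of a negative Minkowski square is a negative
  real, so the bound applies off the light cone too.\<close>

lemma abs_besselJ1_div_le:
  assumes "m \<ge> 0" shows "\<bar>besselJ1 (m * s) / s\<bar> \<le> m / 2"
proof (cases "s = 0")
  case False
  have "besselJ1 (m * s) / s = m * J1_series ((m * s)\<^sup>2)"
    using False by (simp add: besselJ1_eq)
  then show ?thesis
    using mult_left_mono[OF abs_J1_series_le[of "(m * s)\<^sup>2"] assms] assms by (simp add: abs_mult)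
qed (use assms in simp)

lemma borel_measurable_besselJ1 [measurable]: "besselJ1 \<in> borel_measurable borel"
  unfolding besselJ1_def by measurable

section \<open>Zonal integrals over the sphere\<close>

text \<open>The derivative in \<open>\<alpha>\<close> is the integral of a divergence on the sphere:
  it equals \<open>\<partial>\<phi> (cos \<theta> sin (\<phi> - \<gamma>) F) - \<partial>\<theta> (sin \<theta> cos (\<phi> - \<gamma>) F)\<close>.\<close>

lemma sphere_integral_tilt_invariant:
  fixes F F' :: "real \<Rightarrow> real"
  assumes F: "\<And>x. (F has_real_derivative F' x) (at x)" and F': "continuous_on UNIV F'"
  shows "integral (cbox (0, 0) (pi, 2 * pi))
           (\<lambda>p. sin (fst p) * F (sin \<alpha> * sin (fst p) * cos (snd p - \<gamma>) + cos \<alpha> * cos (fst p)))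
       = integral (cbox (0, 0) (pi, 2 * pi)) (\<lambda>p. sin (fst p) * F (cos (fst p)))"
proof -
  let ?B = "cbox (0, 0) (pi, 2 * pi)"
  define u where "u = (\<lambda>\<alpha> \<theta> \<phi>. sin \<alpha> * sin \<theta> * cos (\<phi> - \<gamma>) + cos \<alpha> * cos \<theta>)"
  define f where "f = (\<lambda>\<alpha> p. sin (fst p) * F (u \<alpha> (fst p) (snd p)))"
  define f' where "f' = (\<lambda>\<alpha> p. sin (fst p) * (F' (u \<alpha> (fst p) (snd p)) *
      (cos \<alpha> * sin (fst p) * cos (snd p - \<gamma>) - sin \<alpha> * cos (fst p))))"
  have contF: "continuous_on UNIV F"
    using F by (meson DERIV_isCont continuous_at_imp_continuous_on)
  note ci [continuous_intros] = continuous_on_compose2[OF contF _ subset_UNIV] continuous_on_compose2[OF F' _ subset_UNIV]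
  \<comment> \<open>\<open>P'\<close> and \<open>Q'\<close> are the \<theta>- and \<phi>-derivatives
    of the two flux components. The first flux vanishes at both poles through its factor sin
    \<theta>, the second has period 2 pi in \<phi>, so neither leaves a boundary term.\<close>
  define P' where "P' = (\<lambda>\<alpha> \<theta> \<phi>. cos \<theta> * cos (\<phi> - \<gamma>) * F (u \<alpha> \<theta> \<phi>) +
      sin \<theta> * cos (\<phi> - \<gamma>) * (F' (u \<alpha> \<theta> \<phi>) * (sin \<alpha> * cos \<theta> * cos (\<phi> - \<gamma>) - cos \<alpha> * sin \<theta>)))"
  define Q' where "Q' = (\<lambda>\<alpha> \<theta> \<phi>. cos \<theta> * cos (\<phi> - \<gamma>) * F (u \<alpha> \<theta> \<phi>) -
      cos \<theta> * sin (\<phi> - \<gamma>) * (F' (u \<alpha> \<theta> \<phi>) * (sin \<alpha> * sin \<theta> * sin (\<phi> - \<gamma>))))"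
  have f'_eq: "f' \<alpha> p = Q' \<alpha> (fst p) (snd p) - P' \<alpha> (fst p) (snd p)" for \<alpha> p
  proof -
    have s: "(sin (snd p - \<gamma>))\<^sup>2 = 1 - (cos (snd p - \<gamma>))\<^sup>2" by (simp add: sin_squared_eq)
    have "Q' \<alpha> (fst p) (snd p) - P' \<alpha> (fst p) (snd p) = - sin (fst p) * F' (u \<alpha> (fst p) (snd p)) *
       (cos (fst p) * sin \<alpha> * (sin (snd p - \<gamma>))\<^sup>2 + cos (snd p - \<gamma>) * (sin \<alpha> * cos (fst p) * cos (snd p - \<gamma>) - cos \<alpha> * sin (fst p)))"
      by (simp add: P'_def Q'_def algebra_simps power2_eq_square)
    also have "\<dots> = f' \<alpha> p"
      unfolding s f'_def by (simp add: algebra_simps power2_eq_square)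
    finally show ?thesis by simp
  qed
  have contP: "continuous_on S (\<lambda>p. P' \<alpha> (fst p) (snd p))"
    and contQ: "continuous_on S (\<lambda>p. Q' \<alpha> (fst p) (snd p))" for \<alpha> S
    unfolding P'_def Q'_def u_def by (intro continuous_intros; simp)+
  have zero: "integral ?B (f' \<alpha>) = 0" for \<alpha>
  proof -
    have dP: "((\<lambda>\<theta>. sin \<theta> * cos (\<phi> - \<gamma>) * F (u \<alpha> \<theta> \<phi>)) has_real_derivative P' \<alpha> \<theta> \<phi>) (at \<theta>)" for \<theta> \<phi>
      unfolding P'_def u_def by (auto intro!: derivative_eq_intros DERIV_chain2[OF F] simp: algebra_simps)
    have dQ: "((\<lambda>\<phi>. cos \<theta> * sin (\<phi> - \<gamma>) * F (u \<alpha> \<theta> \<phi>)) has_real_derivative Q' \<alpha> \<theta> \<phi>) (at \<phi>)" for \<theta> \<phi>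
      unfolding Q'_def u_def by (auto intro!: derivative_eq_intros DERIV_chain2[OF F] simp: algebra_simps)
    have iP: "integral {0..pi} (\<lambda>\<theta>. P' \<alpha> \<theta> \<phi>) = 0" for \<phi>
    proof -
      have "((\<lambda>\<theta>. P' \<alpha> \<theta> \<phi>) has_integral sin pi * cos (\<phi> - \<gamma>) * F (u \<alpha> pi \<phi>) - sin 0 * cos (\<phi> - \<gamma>) * F (u \<alpha> 0 \<phi>)) {0..pi}"
        by (rule fundamental_theorem_of_calculus)
           (auto intro: has_field_derivative_at_within[OF dP] simp flip: has_real_derivative_iff_has_vector_derivative)
      then show ?thesis by (simp add: integral_unique)
    qed
    have iQ: "integral {0..2 * pi} (\<lambda>\<phi>. Q' \<alpha> \<theta> \<phi>) = 0" for \<theta>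
    proof -
      have per: "sin (2 * pi - \<gamma>) = sin (0 - \<gamma>)" "cos (2 * pi - \<gamma>) = cos (0 - \<gamma>)"
        by (simp_all add: sin_diff cos_diff)
      have "((\<lambda>\<phi>. Q' \<alpha> \<theta> \<phi>) has_integral cos \<theta> * sin (2 * pi - \<gamma>) * F (u \<alpha> \<theta> (2 * pi)) - cos \<theta> * sin (0 - \<gamma>) * F (u \<alpha> \<theta> 0)) {0..2 * pi}"
        by (rule fundamental_theorem_of_calculus)
           (auto intro: has_field_derivative_at_within[OF dQ] simp flip: has_real_derivative_iff_has_vector_derivative)
      then show ?thesis unfolding u_def per by (simp add: integral_unique)
    qed
    have "integral ?B (\<lambda>p. Q' \<alpha> (fst p) (snd p)) = integral (cbox 0 pi) (\<lambda>\<theta>. integral (cbox 0 (2 * pi)) (\<lambda>\<phi>. Q' \<alpha> \<theta> \<phi>))"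
      by (subst integral_prod_continuous; simp add: contQ case_prod_unfold)
    also have "\<dots> = 0" by (simp add: iQ)
    finally have Q0: "integral ?B (\<lambda>p. Q' \<alpha> (fst p) (snd p)) = 0" .
    have "integral ?B (\<lambda>p. P' \<alpha> (fst p) (snd p)) = integral (cbox 0 pi) (\<lambda>\<theta>. integral (cbox 0 (2 * pi)) (\<lambda>\<phi>. P' \<alpha> \<theta> \<phi>))"
      by (subst integral_prod_continuous; simp add: contP case_prod_unfold)
    also have "\<dots> = integral (cbox 0 (2 * pi)) (\<lambda>\<phi>. integral (cbox 0 pi) (\<lambda>\<theta>. P' \<alpha> \<theta> \<phi>))"
      by (rule integral_swap_continuous) (simp add: contP case_prod_unfold)
    also have "\<dots> = 0" by (simp add: iP)
    finally have P0: "integral ?B (\<lambda>p. P' \<alpha> (fst p) (snd p)) = 0" .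
    show ?thesis unfolding f'_eq
      by (subst integral_diff) (auto intro!: integrable_continuous contP contQ simp: P0 Q0)
  qed
  have "((\<lambda>\<alpha>. integral ?B (f \<alpha>)) has_field_derivative integral ?B (f' \<alpha>)) (at \<alpha> within UNIV)" for \<alpha>
  proof (rule leibniz_rule_field_derivative)
    show "((\<lambda>x. f x t) has_real_derivative f' x t) (at x within UNIV)" for x t
      unfolding f_def f'_def u_def by (auto intro!: derivative_eq_intros DERIV_chain2[OF F] simp: algebra_simps)
    show "f x integrable_on ?B" for x
      unfolding f_def u_def by (intro integrable_continuous continuous_intros; simp)
    show "continuous_on (UNIV \<times> ?B) (\<lambda>(x, t). f' x t)"
      unfolding f'_def u_def case_prod_unfold by (intro continuous_intros; simp)
  qed auto
  then have "((\<lambda>\<alpha>. integral ?B (f \<alpha>)) has_field_derivative 0) (at \<alpha>)" for \<alpha>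
    by (simp add: zero)
  then have "integral ?B (f \<alpha>) = integral ?B (f 0)"
    by (intro DERIV_isconst_all) simp
  then show ?thesis by (simp add: f_def u_def)
qed


section \<open>The uniform distribution on the sphere in angular coordinates\<close>

lemma borel_measurable_fst [measurable]:
  "(fst :: 'a::topological_space \<times> 'b::topological_space \<Rightarrow> 'a) \<in> borel_measurable borel"
  and borel_measurable_snd [measurable]:
  "(snd :: 'a::topological_space \<times> 'b::topological_space \<Rightarrow> 'b) \<in> borel_measurable borel"
  by (auto intro!: borel_measurable_continuous_onI continuous_intros)

text \<open>Normalised surface measure carried to the angle rectangle. The factor 1/(4 pi) makes it
  a probability measure, so that functions of the angles have distributions and characteristic
  functions.\<close>

definition sphere_chart_measure :: "(real \<times> real) measure" where
  "sphere_chart_measure = density lborel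
     (\<lambda>p. ennreal (sin (fst p) / (4 * pi)) * indicator (cbox (0, 0) (pi, 2 * pi)) p)"

lemma space_sphere_chart_measure [simp]: "space sphere_chart_measure = UNIV"
  and sets_sphere_chart_measure [measurable_cong]: "sets sphere_chart_measure = sets borel"
  by (simp_all add: sphere_chart_measure_def)

lemma nn_integral_sphere_chart:
  assumes [measurable]: "f \<in> borel_measurable borel"
  shows "(\<integral>\<^sup>+p. f p \<partial>sphere_chart_measure) =
    (\<integral>\<^sup>+th. (\<integral>\<^sup>+ph. ennreal (sin th / (4 * pi)) * f (th, ph) * indicator {0..2 * pi} ph \<partial>lborel) * indicator {0..pi} th \<partial>lborel)"
proof -
  have "(\<integral>\<^sup>+p. f p \<partial>sphere_chart_measure) =
      (\<integral>\<^sup>+p. ennreal (sin (fst p) / (4 * pi)) * indicator (cbox (0, 0) (pi, 2 * pi)) p * f p \<partial>(lborel \<Otimes>\<^sub>M lborel))"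
    unfolding sphere_chart_measure_def lborel_prod by (subst nn_integral_density) auto
  also have "\<dots> = (\<integral>\<^sup>+th. (\<integral>\<^sup>+ph. ennreal (sin th / (4 * pi)) * indicator (cbox (0, 0) (pi, 2 * pi)) (th, ph) * f (th, ph) \<partial>lborel) \<partial>lborel)"
    by (subst lborel.nn_integral_fst[symmetric]) (auto simp: lborel_prod)
  also have "\<dots> = (\<integral>\<^sup>+th. (\<integral>\<^sup>+ph. ennreal (sin th / (4 * pi)) * f (th, ph) * indicator {0..2 * pi} ph \<partial>lborel) * indicator {0..pi} th \<partial>lborel)"
    by (intro nn_integral_cong, subst nn_integral_multc[symmetric])
       (auto intro!: nn_integral_cong simp: indicator_def)
  finally show ?thesis .
qed

text \<open>The hat-box theorem for the coordinate axis: integrating out \<phi> leaves (1/2) sin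
  \<theta> d\<theta>, which u = cos \<theta> turns into half the Lebesgue measure on
  [-1, 1].\<close>

lemma nn_integral_sphere_chart_polar:
  assumes [measurable]: "f \<in> borel_measurable borel"
  shows "(\<integral>\<^sup>+p. f (cos (fst p)) \<partial>sphere_chart_measure) = ennreal (1 / 2) * (\<integral>\<^sup>+u. f u * indicator {-1..1} u \<partial>lborel)"
proof -
  have "(\<integral>\<^sup>+p. f (cos (fst p)) \<partial>sphere_chart_measure) =
    (\<integral>\<^sup>+th. (\<integral>\<^sup>+ph. (ennreal (sin th / (4 * pi)) * f (cos th)) * indicator {0..2 * pi} ph \<partial>lborel) * indicator {0..pi} th \<partial>lborel)"
    by (subst nn_integral_sphere_chart) auto
  also have "\<dots> = (\<integral>\<^sup>+th. ennreal (1 / 2) * (f (cos th) * ennreal (sin th) * indicator {0..pi} th) \<partial>lborel)"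
  proof (rule nn_integral_cong)
    fix th
    have "(\<integral>\<^sup>+ph. (ennreal (sin th / (4 * pi)) * f (cos th)) * indicator {0..2 * pi} ph \<partial>lborel)
       = (ennreal (2 * pi) * ennreal (sin th / (4 * pi))) * f (cos th)"
      by (subst nn_integral_cmult_indicator) (auto simp: mult_ac)
    also have "ennreal (2 * pi) * ennreal (sin th / (4 * pi)) = ennreal (1 / 2) * ennreal (sin th)"
      by (subst (1 2) ennreal_mult'[symmetric]) simp_all
    finally show "(\<integral>\<^sup>+ph. (ennreal (sin th / (4 * pi)) * f (cos th)) * indicator {0..2 * pi} ph \<partial>lborel) * indicator {0..pi} th
      = ennreal (1 / 2) * (f (cos th) * ennreal (sin th) * indicator {0..pi} th)"
      by (simp add: mult_ac)
  qed
  also have "\<dots> = ennreal (1 / 2) * (\<integral>\<^sup>+th. f (cos th) * ennreal (sin th) * indicator {0..pi} th \<partial>lborel)"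
    by (rule nn_integral_cmult) simp
  \<comment> \<open>-cos is increasing on [0, pi], as the substitution rule requires; the sign is
    removed afterwards by reflecting u.\<close>
  also have "(\<integral>\<^sup>+th. f (cos th) * ennreal (sin th) * indicator {0..pi} th \<partial>lborel)
      = (\<integral>\<^sup>+th. f (- (- cos th)) * ennreal (sin th) * indicator {0..pi} th \<partial>lborel)" by simp
  also have "\<dots> = (\<integral>\<^sup>+u. f (- u) * indicator {- cos 0..- cos pi} u \<partial>lborel)"
    by (rule nn_integral_substitution_aux[symmetric, where f="\<lambda>u. f (- u)"])
       (auto intro!: derivative_eq_intros continuous_intros simp: sin_ge_zero)
  also have "\<dots> = (\<integral>\<^sup>+u. f u * indicator {-1..1} u \<partial>lborel)"
    by (subst (2) nn_integral_real_affine[where c="-1" and t=0])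
       (auto intro!: nn_integral_cong simp: indicator_def)
  finally show ?thesis .
qed

lemma prob_space_sphere_chart_measure: "prob_space sphere_chart_measure"
proof
  have "emeasure sphere_chart_measure (space sphere_chart_measure) = (\<integral>\<^sup>+p. 1 \<partial>sphere_chart_measure)"
    by simp
  also have "\<dots> = ennreal (1 / 2) * (\<integral>\<^sup>+u. 1 * indicator {-1..1::real} u \<partial>lborel)"
    by (rule nn_integral_sphere_chart_polar) simp
  also have "\<dots> = ennreal (1 / 2) * ennreal 2" by simp
  also have "\<dots> = 1" by (subst ennreal_mult'[symmetric]) auto
  finally show "emeasure sphere_chart_measure (space sphere_chart_measure) = 1" .
qed

lemma integral_sphere_chart:
  fixes h :: "real \<times> real \<Rightarrow> real"
  assumes h: "continuous_on UNIV h"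
  shows "(\<integral>p. h p \<partial>sphere_chart_measure) = integral (cbox (0, 0) (pi, 2 * pi)) (\<lambda>p. sin (fst p) * h p) / (4 * pi)"
proof -
  let ?B = "cbox (0, 0) (pi, 2 * pi :: real)"
  have [measurable]: "h \<in> borel_measurable borel"
    using h by (rule borel_measurable_continuous_onI)
  have M: "sphere_chart_measure = density lborel (\<lambda>p. ennreal (sin (fst p) / (4 * pi) * indicator ?B p))"
    unfolding sphere_chart_measure_def by (intro density_cong AE_I2) (auto split: split_indicator)
  have "(\<integral>p. h p \<partial>sphere_chart_measure) = (\<integral>p. (sin (fst p) / (4 * pi) * indicator ?B p) *\<^sub>R h p \<partial>lborel)"
    unfolding M by (subst integral_density) (auto simp: indicator_def intro!: AE_I2 divide_nonneg_nonneg sin_ge_zero)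
  also have "\<dots> = (LINT p:?B|lborel. sin (fst p) * h p / (4 * pi))"
    unfolding set_lebesgue_integral_def by (rule Bochner_Integration.integral_cong) (auto simp: indicator_def)
  also have "\<dots> = integral ?B (\<lambda>p. sin (fst p) * h p / (4 * pi))"
  proof (rule set_borel_integral_eq_integral)
    show "set_integrable lborel ?B (\<lambda>p. sin (fst p) * h p / (4 * pi))"
      unfolding set_integrable_def
      by (rule borel_integrable_compact) (auto intro!: continuous_intros continuous_on_subset[OF h])
  qed
  finally show ?thesis by simp
qed

text \<open>Tilt invariance is available for continuously differentiable F. Applied to cos (t x) and
  sin (t x) it equates the characteristic functions of the two laws, and these determine the
  laws.\<close>

lemma distr_sphere_chart_tilt:
  "distr sphere_chart_measure borel (\<lambda>p. sin \<alpha> * sin (fst p) * cos (snd p - \<gamma>) + cos \<alpha> * cos (fst p))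
    = distr sphere_chart_measure borel (\<lambda>p. cos (fst p))" (is "distr ?M borel ?X = distr ?M borel ?Y")
proof (rule Levy_uniqueness)
  interpret prob_space ?M by (rule prob_space_sphere_chart_measure)
  show "real_distribution (distr ?M borel ?X)" "real_distribution (distr ?M borel ?Y)"
    by (auto intro!: real_distribution_distr)
  have cX: "continuous_on UNIV ?X" and cY: "continuous_on UNIV ?Y"
    by (intro continuous_intros)+
  have [measurable]: "?X \<in> borel_measurable borel" "?Y \<in> borel_measurable borel" by measurable
  show "char (distr ?M borel ?X) = char (distr ?M borel ?Y)"
  proof (rule ext)
    fix t
    have int: "integrable ?M (\<lambda>p. iexp (t * Z p))" if [measurable]: "Z \<in> borel_measurable borel" for Z
      by (intro integrable_const_bound[where B=1]) auto
    have rot: "(\<integral>p. F (?X p) \<partial>?M) = (\<integral>p. F (?Y p) \<partial>?M)"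
      if F: "\<And>x. (F has_real_derivative F' x) (at x)" and F': "continuous_on UNIV F'" for F F' :: "real \<Rightarrow> real"
    proof -
      have cF: "continuous_on UNIV F"
        using F by (meson DERIV_isCont continuous_at_imp_continuous_on)
      show ?thesis
        by (subst (1 2) integral_sphere_chart)
           (auto intro!: continuous_on_compose2[OF cF] cX cY simp: sphere_integral_tilt_invariant[OF F F'])
    qed
    have re: "Re (char (distr ?M borel Z) t) = (\<integral>p. cos (t * Z p) \<partial>?M)"
      and im: "Im (char (distr ?M borel Z) t) = (\<integral>p. sin (t * Z p) \<partial>?M)"
      if [measurable]: "Z \<in> borel_measurable borel" for Z
    proof -
      have c: "char (distr ?M borel Z) t = (\<integral>p. iexp (t * Z p) \<partial>?M)"
        unfolding char_def by (subst integral_distr) auto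
      show "Re (char (distr ?M borel Z) t) = (\<integral>p. cos (t * Z p) \<partial>?M)"
        unfolding c integral_Re[OF int[OF that], symmetric] by (simp add: Re_exp)
      show "Im (char (distr ?M borel Z) t) = (\<integral>p. sin (t * Z p) \<partial>?M)"
        unfolding c integral_Im[OF int[OF that], symmetric] by (simp add: Im_exp)
    qed
    show "char (distr ?M borel ?X) t = char (distr ?M borel ?Y) t"
    proof (rule complex_eqI)
      have "(\<integral>p. cos (t * ?X p) \<partial>?M) = (\<integral>p. cos (t * ?Y p) \<partial>?M)"
        by (rule rot[of "\<lambda>x. cos (t * x)" "\<lambda>x. - sin (t * x) * t"])
           (auto intro!: derivative_eq_intros continuous_intros)
      then show "Re (char (distr ?M borel ?X) t) = Re (char (distr ?M borel ?Y) t)"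
        by (subst (1 2) re) simp_all
      have "(\<integral>p. sin (t * ?X p) \<partial>?M) = (\<integral>p. sin (t * ?Y p) \<partial>?M)"
        by (rule rot[of "\<lambda>x. sin (t * x)" "\<lambda>x. cos (t * x) * t"])
           (auto intro!: derivative_eq_intros continuous_intros)
      then show "Im (char (distr ?M borel ?X) t) = Im (char (distr ?M borel ?Y) t)"
        by (subst (1 2) im) simp_all
    qed
  qed
qed

text \<open>\<alpha> and \<gamma> are the polar and azimuthal angles of \<open>e\<close>, and the
  formula is the spherical law of cosines. When sin \<alpha> = 0 the azimuth is arbitrary and 0 is
  taken.\<close>

lemma sphpt_inner_unit:
  assumes "norm e = 1"
  obtains \<alpha> \<gamma> where "\<And>th ph. sphpt th ph \<bullet> e = sin \<alpha> * sin th * cos (ph - \<gamma>) + cos \<alpha> * cos th"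
proof -
  have n: "(e $ 1)\<^sup>2 + (e $ 2)\<^sup>2 + (e $ 3)\<^sup>2 = 1"
    using assms by (simp add: norm_eq_1 inner_vec_def sum_3 power2_eq_square)
  define \<alpha> where "\<alpha> = arccos (e $ 3)"
  have "(e $ 3)\<^sup>2 \<le> 1" using n zero_le_power2[of "e $ 1"] zero_le_power2[of "e $ 2"] by linarith
  then have e3: "\<bar>e $ 3\<bar> \<le> 1" by (simp add: abs_square_le_1)
  then have ca: "cos \<alpha> = e $ 3" unfolding \<alpha>_def by (intro cos_arccos_abs)
  have sa: "(sin \<alpha>)\<^sup>2 = (e $ 1)\<^sup>2 + (e $ 2)\<^sup>2" using n ca by (simp add: sin_squared_eq)
  obtain \<gamma> where g: "e $ 1 = sin \<alpha> * cos \<gamma>" "e $ 2 = sin \<alpha> * sin \<gamma>"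
  proof (cases "sin \<alpha> = 0")
    case True
    then have "e $ 1 = 0" "e $ 2 = 0" using sa by (auto simp: sum_power2_eq_zero_iff)
    with True that[of 0] show ?thesis by simp
  next
    case False
    then have "(e $ 1 / sin \<alpha>)\<^sup>2 + (e $ 2 / sin \<alpha>)\<^sup>2 = 1"
      using sa[symmetric] by (simp add: power_divide flip: add_divide_distrib)
    then obtain \<gamma> where "e $ 1 / sin \<alpha> = cos \<gamma>" "e $ 2 / sin \<alpha> = sin \<gamma>"
      by (rule sincos_total_2pi)
    with False that[of \<gamma>] show ?thesis by (simp add: field_simps)
  qed
  show ?thesis
    by (rule that[of \<alpha> \<gamma>])
       (simp add: inner_vec_def sum_3 sphpt_def g ca[symmetric] cos_diff algebra_simps)
qed

lemma continuous_on_sphpt: "continuous_on UNIV (\<lambda>p. sphpt (fst p) (snd p))"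
  unfolding sphpt_def
proof (rule continuous_on_vec_lambda)
  fix i :: 3
  show "continuous_on UNIV (\<lambda>p::real \<times> real. if i = 1 then sin (fst p) * cos (snd p)
      else if i = 2 then sin (fst p) * sin (snd p) else cos (fst p))"
    by (cases "i = 1"; cases "i = 2") (auto intro!: continuous_intros)
qed

lemma measurable_sphpt [measurable (raw)]:
  assumes "f \<in> borel_measurable M" "h \<in> borel_measurable M"
  shows "(\<lambda>x. sphpt (f x) (h x)) \<in> borel_measurable M"
  using measurable_compose[OF borel_measurable_Pair[OF assms] borel_measurable_continuous_onI[OF continuous_on_sphpt]]
  by simp

text \<open>The hat-box theorem for an arbitrary axis: the height along \<open>e\<close> has the
  same law as cos \<theta>, and area 4 pi times density 1/2 is 2 pi. The left side has the shape
  that \<open>norm_sphere_integral_le\<close> produces.\<close>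

lemma nn_integral_sphere_zonal:
  assumes f [measurable]: "f \<in> borel_measurable borel" and "norm e = 1"
  shows "(\<integral>\<^sup>+th. (\<integral>\<^sup>+ph. ennreal (sin th) * f (sphpt th ph \<bullet> e) * indicator {0..2 * pi} ph \<partial>lborel) * indicator {0..pi} th \<partial>lborel)
     = ennreal (2 * pi) * (\<integral>\<^sup>+u. f u * indicator {-1..1} u \<partial>lborel)"
proof -
  let ?M = sphere_chart_measure
  obtain \<alpha> \<gamma> where e: "\<And>th ph. sphpt th ph \<bullet> e = sin \<alpha> * sin th * cos (ph - \<gamma>) + cos \<alpha> * cos th"
    using sphpt_inner_unit[OF assms(2)] by blast
  have "(\<integral>\<^sup>+th. (\<integral>\<^sup>+ph. ennreal (sin th) * f (sphpt th ph \<bullet> e) * indicator {0..2 * pi} ph \<partial>lborel) * indicator {0..pi} th \<partial>lborel)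
     = (\<integral>\<^sup>+th. ennreal (4 * pi) * ((\<integral>\<^sup>+ph. ennreal (sin th / (4 * pi)) * f (sphpt th ph \<bullet> e) * indicator {0..2 * pi} ph \<partial>lborel) * indicator {0..pi} th) \<partial>lborel)"
  proof (rule nn_integral_cong)
    fix th
    have s: "ennreal (sin th) = ennreal (4 * pi) * ennreal (sin th / (4 * pi))"
      by (simp add: ennreal_mult'[symmetric])
    show "(\<integral>\<^sup>+ph. ennreal (sin th) * f (sphpt th ph \<bullet> e) * indicator {0..2 * pi} ph \<partial>lborel) * indicator {0..pi} th
      = ennreal (4 * pi) * ((\<integral>\<^sup>+ph. ennreal (sin th / (4 * pi)) * f (sphpt th ph \<bullet> e) * indicator {0..2 * pi} ph \<partial>lborel) * indicator {0..pi} th)"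
      unfolding s by (subst nn_integral_cmult[symmetric] mult.assoc[symmetric])+ (simp_all add: mult.assoc)
  qed
  also have "\<dots> = ennreal (4 * pi) * (\<integral>\<^sup>+th. (\<integral>\<^sup>+ph. ennreal (sin th / (4 * pi)) * f (sphpt th ph \<bullet> e) * indicator {0..2 * pi} ph \<partial>lborel) * indicator {0..pi} th \<partial>lborel)"
    by (rule nn_integral_cmult) measurable
  also have "(\<integral>\<^sup>+th. (\<integral>\<^sup>+ph. ennreal (sin th / (4 * pi)) * f (sphpt th ph \<bullet> e) * indicator {0..2 * pi} ph \<partial>lborel) * indicator {0..pi} th \<partial>lborel)
     = (\<integral>\<^sup>+p. f (sphpt (fst p) (snd p) \<bullet> e) \<partial>?M)"
    by (subst nn_integral_sphere_chart) auto
  also have "\<dots> = integral\<^sup>N (distr ?M borel (\<lambda>p. sin \<alpha> * sin (fst p) * cos (snd p - \<gamma>) + cos \<alpha> * cos (fst p))) f"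
    by (subst nn_integral_distr) (auto simp: e)
  also have "\<dots> = (\<integral>\<^sup>+p. f (cos (fst p)) \<partial>?M)"
    unfolding distr_sphere_chart_tilt by (subst nn_integral_distr) auto
  also have "\<dots> = ennreal (1 / 2) * (\<integral>\<^sup>+u. f u * indicator {-1..1} u \<partial>lborel)"
    by (rule nn_integral_sphere_chart_polar) fact
  also have "ennreal (4 * pi) * (ennreal (1 / 2) * (\<integral>\<^sup>+u. f u * indicator {-1..1} u \<partial>lborel))
      = ennreal (2 * pi) * (\<integral>\<^sup>+u. f u * indicator {-1..1} u \<partial>lborel)"
    by (subst mult.assoc[symmetric], subst ennreal_mult'[symmetric]) simp_all
  finally show ?thesis .
qed

section \<open>Integrals of monotone weights\<close>

text \<open>Holds for every f: without integrability the left side is 0. Upper bounds on the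
  operators therefore never require an integrability proof for their integrands.\<close>

lemma norm_lebesgue_integral_le_nn_integral:
  fixes f :: "'a \<Rightarrow> 'b::{banach, second_countable_topology}"
  shows "ennreal (norm (integral\<^sup>L M f)) \<le> (\<integral>\<^sup>+x. ennreal (norm (f x)) \<partial>M)"
  by (cases "integrable M f") (auto simp: integral_norm_bound_ennreal not_integrable_integral_eq)

lemma norm_set_lebesgue_integral_le_nn_integral:
  fixes f :: "'a \<Rightarrow> 'b::{banach, second_countable_topology}"
  shows "ennreal (norm (set_lebesgue_integral M A f)) \<le> (\<integral>\<^sup>+x. ennreal (norm (f x)) * indicator A x \<partial>M)"
  unfolding set_lebesgue_integral_def
  by (rule order_trans[OF norm_lebesgue_integral_le_nn_integral], rule nn_integral_mono)
     (auto simp: indicator_def)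

text \<open>Polar coordinates for radial functions: both measures give {..r} the volume of the ball
  of radius r, which is 0 for negative r, and these half-lines form a generator closed under
  intersection.\<close>

lemma distr_dist_lborel:
  fixes c :: "real^3"
  shows "distr lborel borel (dist c) = density lborel (\<lambda>s. ennreal (4 * pi * s\<^sup>2) * indicator {0..} s)"
    (is "?M = ?N")
proof (rule measure_eqI_generator_eq[where E="range (\<lambda>a. {..a::real})" and \<Omega>=UNIV and A="\<lambda>i. {..real i}"])
  have eq: "emeasure ?M {..r} = ennreal (4 / 3 * pi * r ^ 3) * indicator {0..} r" for r
  proof -
    have "emeasure ?M {..r} = emeasure lborel (cball c r)"
      by (subst emeasure_distr) (auto intro!: arg_cong[where f="emeasure lborel"])
    also have "\<dots> = ennreal (4 / 3 * pi * r ^ 3) * indicator {0..} r"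
    proof (cases "r \<ge> 0")
      case True
      then show ?thesis by (simp add: emeasure_cball unit_ball_vol_3)
    next
      case False
      then have "cball c r = {}" by auto
      with False show ?thesis by simp
    qed
    finally show ?thesis .
  qed
  show "emeasure ?M X = emeasure ?N X" if "X \<in> range (\<lambda>a. {..a::real})" for X
  proof -
    from that obtain r where X: "X = {..r}" by auto
    have "emeasure ?N X = (\<integral>\<^sup>+s. ennreal (4 * pi * s\<^sup>2) * indicator {0..r} s \<partial>lborel)"
      unfolding X by (subst emeasure_density) (auto intro!: nn_integral_cong simp: indicator_def)
    also have "\<dots> = ennreal (4 / 3 * pi * r ^ 3) * indicator {0..} r"
    proof (cases "r \<ge> 0")
      case True
      have "(\<integral>\<^sup>+s. ennreal (4 * pi * s\<^sup>2) * indicator {0..r} s \<partial>lborel)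
          = ennreal (4 / 3 * pi * r ^ 3 - 4 / 3 * pi * 0 ^ 3)"
        by (rule nn_integral_FTC_Icc)
           (auto intro!: derivative_eq_intros simp: True power2_eq_square)
      with True show ?thesis by simp
    qed simp
    finally show ?thesis using eq X by simp
  qed
  show "\<And>i. emeasure ?M {..real i} \<noteq> \<infinity>" unfolding eq by (auto simp: ennreal_mult_eq_top_iff indicator_def)
  have "sets (borel :: real measure) = sigma_sets UNIV (range (\<lambda>a. {..a::real}))"
    by (subst borel_eq_atMost) (rule sets_measure_of, simp)
  then show "sets ?M = sigma_sets UNIV (range (\<lambda>a. {..a::real}))"
    "sets ?N = sigma_sets UNIV (range (\<lambda>a. {..a::real}))"
    by simp_all
  show "(\<Union>i. {..real i}) = UNIV"
    using real_arch_simple by (intro set_eqI) auto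
  have "{..a} \<inter> {..b} = {..min a b}" for a b :: real by auto
  then show "Int_stable (range (\<lambda>a. {..a::real}))"
    unfolding Int_stable_def by blast
qed auto

lemma nn_integral_radial:
  fixes c :: "real^3"
  assumes [measurable]: "F \<in> borel_measurable borel"
  shows "(\<integral>\<^sup>+z. F (dist c z) \<partial>lborel) = (\<integral>\<^sup>+s. ennreal (4 * pi * s\<^sup>2) * indicator {0..} s * F s \<partial>lborel)"
proof -
  have "(\<integral>\<^sup>+z. F (dist c z) \<partial>lborel) = integral\<^sup>N (distr lborel borel (dist c)) F"
    by (subst nn_integral_distr) auto
  also have "\<dots> = (\<integral>\<^sup>+s. ennreal (4 * pi * s\<^sup>2) * indicator {0..} s * F s \<partial>lborel)"
    unfolding distr_dist_lborel by (subst nn_integral_density) auto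
  finally show ?thesis .
qed

text \<open>Vanishing at negative times builds the support condition x^0 \<ge> 0 into the weight and
  keeps it monotone on the whole line, so time integrals need no separate lower limit.\<close>

locale weight =
  fixes G :: "real \<Rightarrow> real"
  assumes mono: "mono G" and neg: "\<And>t. t < 0 \<Longrightarrow> G t = 0"
begin

lemma nonneg [simp]: "G t \<ge> 0"
proof (cases "t < 0")
  case False
  then show ?thesis using monoD[OF mono, of "-1" t] neg[of "-1"] by simp
qed (simp add: neg)

lemma measurable_G [measurable]: "G \<in> borel_measurable borel"
  using mono by (rule borel_measurable_mono)

text \<open>Taken in \<open>ennreal\<close> so that kernel estimates can be multiplied and reordered
  freely; \<open>rint_finite\<close> settles finiteness before the passage to the real-valued
  \<open>giter\<close>.\<close>

definition rint :: "nat \<Rightarrow> real \<Rightarrow> ennreal" where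
  "rint k t = (\<integral>\<^sup>+u. ennreal ((t - u) ^ k * G u) * indicator {0..t} u \<partial>lborel)"

lemma rint_0_reflect: "(\<integral>\<^sup>+r. ennreal (G (t - r)) * indicator {0..t} r \<partial>lborel) = rint 0 t"
  unfolding rint_def
  by (subst nn_integral_real_affine[where c="-1" and t=t]) (auto intro!: nn_integral_cong simp: indicator_def)

lemma nn_integral_radial_weight:
  fixes c :: "real^3"
  shows "(\<integral>\<^sup>+z. ennreal (G (t - dist c z) / dist c z) \<partial>lborel) = ennreal (4 * pi) * rint 1 t"
proof -
  have "(\<integral>\<^sup>+z. ennreal (G (t - dist c z) / dist c z) \<partial>lborel)
      = (\<integral>\<^sup>+s. ennreal (4 * pi * s\<^sup>2) * indicator {0..} s * ennreal (G (t - s) / s) \<partial>lborel)"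
    by (rule nn_integral_radial) simp
  also have "\<dots> = (\<integral>\<^sup>+s. ennreal (4 * pi) * (ennreal (s * G (t - s)) * indicator {0..t} s) \<partial>lborel)"
    by (rule nn_integral_cong)
       (auto simp: indicator_def ennreal_mult''[symmetric] power2_eq_square neg)
  also have "\<dots> = ennreal (4 * pi) * (\<integral>\<^sup>+s. ennreal (s * G (t - s)) * indicator {0..t} s \<partial>lborel)"
    by (rule nn_integral_cmult) simp
  also have "(\<integral>\<^sup>+s. ennreal (s * G (t - s)) * indicator {0..t} s \<partial>lborel) = rint 1 t"
    unfolding rint_def
    by (subst nn_integral_real_affine[where c="-1" and t=t]) (auto intro!: nn_integral_cong simp: indicator_def)
  finally show ?thesis .
qed

text \<open>Splitting by the nearer pole, with p = dist a z and q = dist b z: if p \<le> q, then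
  1/(p q) \<le> 1/p^2; otherwise monotonicity also gives G (t - p) \<le> G (t - q), so the weight
  can be recentred at \<open>b\<close>. Each inverse square cancels against 4 pi s^2, which makes
  the bound independent of the distance between the poles.\<close>

lemma nn_integral_two_poles:
  fixes a b :: "real^3"
  shows "(\<integral>\<^sup>+z. ennreal (G (t - dist a z) / (dist a z * dist b z)) \<partial>lborel) \<le> ennreal (8 * pi) * rint 0 t"
proof -
  have pole: "(\<integral>\<^sup>+z. ennreal (G (t - dist c z) / (dist c z)\<^sup>2) \<partial>lborel) \<le> ennreal (4 * pi) * rint 0 t"
    for c :: "real^3"
  proof -
    have "(\<integral>\<^sup>+z. ennreal (G (t - dist c z) / (dist c z)\<^sup>2) \<partial>lborel)
        = (\<integral>\<^sup>+s. ennreal (4 * pi * s\<^sup>2) * indicator {0..} s * ennreal (G (t - s) / s\<^sup>2) \<partial>lborel)"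
      by (rule nn_integral_radial) simp
    also have "\<dots> \<le> (\<integral>\<^sup>+s. ennreal (4 * pi) * (ennreal (G (t - s)) * indicator {0..t} s) \<partial>lborel)"
      by (rule nn_integral_mono)
         (auto simp: indicator_def ennreal_mult''[symmetric] neg)
    also have "\<dots> = ennreal (4 * pi) * rint 0 t"
      by (subst nn_integral_cmult) (simp_all add: rint_0_reflect)
    finally show ?thesis .
  qed
  have pw: "G (t - p) / (p * q) \<le> G (t - p) / p\<^sup>2 + G (t - q) / q\<^sup>2" if "p \<ge> 0" "q \<ge> 0" for p q
  proof (cases "p = 0 \<or> q = 0")
    case False
    then have pq: "p > 0" "q > 0" using that by auto
    show ?thesis
    proof (cases "p \<le> q")
      case True
      then have "G (t - p) / (p * q) \<le> G (t - p) / (p * p)"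
        using pq by (intro divide_left_mono mult_left_mono) auto
      then show ?thesis by (simp add: power2_eq_square add_increasing2)
    next
      case False
      then have "G (t - p) / (p * q) \<le> G (t - q) / (q * q)"
        using pq by (intro frac_le mult_right_mono monoD[OF mono]) auto
      then show ?thesis by (simp add: power2_eq_square add_increasing)
    qed
  qed auto
  have "(\<integral>\<^sup>+z. ennreal (G (t - dist a z) / (dist a z * dist b z)) \<partial>lborel)
    \<le> (\<integral>\<^sup>+z. ennreal (G (t - dist a z) / (dist a z)\<^sup>2) + ennreal (G (t - dist b z) / (dist b z)\<^sup>2) \<partial>lborel)"
    by (rule nn_integral_mono) (simp add: ennreal_plus[symmetric] pw del: ennreal_plus)
  also have "\<dots> = (\<integral>\<^sup>+z. ennreal (G (t - dist a z) / (dist a z)\<^sup>2) \<partial>lborel)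
        + (\<integral>\<^sup>+z. ennreal (G (t - dist b z) / (dist b z)\<^sup>2) \<partial>lborel)"
    by (rule nn_integral_add) auto
  also have "\<dots> \<le> ennreal (4 * pi) * rint 0 t + ennreal (4 * pi) * rint 0 t"
    by (intro add_mono pole)
  also have "\<dots> = ennreal (8 * pi) * rint 0 t"
    by (simp flip: distrib_right ennreal_plus)
  finally show ?thesis .
qed

section \<open>Light-cone integrals with a cut-off in time\<close>

definition cut :: "real \<Rightarrow> real \<Rightarrow> real" where
  "cut X u = (if u \<le> X then G u else 0)"

lemma cut_nonneg [simp]: "cut X u \<ge> 0"
  by (simp add: cut_def)

lemma measurable_cut [measurable]: "cut X \<in> borel_measurable borel"
  unfolding cut_def by measurable

lemma nn_integral_cut: "(\<integral>\<^sup>+u. ennreal (cut X u) \<partial>lborel) = rint 0 X"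
  unfolding rint_def by (rule nn_integral_cong) (auto simp: cut_def indicator_def neg)

text \<open>On the support of \<open>cut\<close>, v + s \<le> X with v \<ge> 0, hence s \<le> X. One
  factor s of 4 pi s^2 cancels the denominator, the other is estimated by X, and a shifted time
  integral remains.\<close>

lemma nn_integral_cone_plus:
  fixes c :: "real^3"
  assumes "v \<ge> 0" "X \<ge> 0"
  shows "(\<integral>\<^sup>+z. ennreal (cut X (v + dist c z) / dist c z) \<partial>lborel) \<le> ennreal (4 * pi * X) * rint 0 X"
proof -
  have "(\<integral>\<^sup>+z. ennreal (cut X (v + dist c z) / dist c z) \<partial>lborel)
      = (\<integral>\<^sup>+s. ennreal (4 * pi * s\<^sup>2) * indicator {0..} s * ennreal (cut X (v + s) / s) \<partial>lborel)"
    by (rule nn_integral_radial) simp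
  also have "\<dots> \<le> (\<integral>\<^sup>+s. ennreal (4 * pi * X) * ennreal (cut X (v + 1 * s)) \<partial>lborel)"
  proof (rule nn_integral_mono)
    fix s
    have "s * cut X (v + s) \<le> X * cut X (v + s)" if "s \<ge> 0"
      using that assms by (auto simp: cut_def intro!: mult_right_mono)
    then have "4 * (pi * (s * cut X (v + s))) \<le> 4 * pi * X * cut X (v + s)" if "s \<ge> 0"
      using that by (simp add: mult.assoc)
    then show "ennreal (4 * pi * s\<^sup>2) * indicator {0..} s * ennreal (cut X (v + s) / s)
         \<le> ennreal (4 * pi * X) * ennreal (cut X (v + 1 * s))"
      by (auto simp: indicator_def ennreal_mult''[symmetric] power2_eq_square intro!: ennreal_leI)
  qed
  also have "\<dots> = ennreal (4 * pi * X) * (\<integral>\<^sup>+s. ennreal (cut X (v + 1 * s)) \<partial>lborel)"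
    by (rule nn_integral_cmult) simp
  also have "(\<integral>\<^sup>+s. ennreal (cut X (v + 1 * s)) \<partial>lborel) = rint 0 X"
    using nn_integral_real_affine[where c=1 and t=v and f="\<lambda>u. ennreal (cut X u)"]
    by (simp add: nn_integral_cut)
  finally show ?thesis .
qed

text \<open>Here G (v - s) = 0 unless s \<le> v, so the surviving factor s is estimated by v, the
  time of the apex of the cone.\<close>

lemma nn_integral_cone_minus:
  fixes c :: "real^3"
  assumes "v \<ge> 0" "X \<ge> 0"
  shows "(\<integral>\<^sup>+z. ennreal (cut X (v - dist c z) / dist c z) \<partial>lborel) \<le> ennreal (4 * pi * v) * rint 0 X"
proof -
  have "(\<integral>\<^sup>+z. ennreal (cut X (v - dist c z) / dist c z) \<partial>lborel)
      = (\<integral>\<^sup>+s. ennreal (4 * pi * s\<^sup>2) * indicator {0..} s * ennreal (cut X (v - s) / s) \<partial>lborel)"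
    by (rule nn_integral_radial) simp
  also have "\<dots> \<le> (\<integral>\<^sup>+s. ennreal (4 * pi * v) * ennreal (cut X (v + - 1 * s)) \<partial>lborel)"
  proof (rule nn_integral_mono)
    fix s
    have "s * cut X (v - s) \<le> v * cut X (v - s)"
      by (cases "s \<le> v") (auto simp: cut_def neg intro!: mult_right_mono)
    then have "4 * (pi * (s * cut X (v - s))) \<le> 4 * pi * v * cut X (v - s)" if "s \<ge> 0"
      using that by (simp add: mult.assoc)
    then show "ennreal (4 * pi * s\<^sup>2) * indicator {0..} s * ennreal (cut X (v - s) / s)
         \<le> ennreal (4 * pi * v) * ennreal (cut X (v + - 1 * s))"
      by (auto simp: indicator_def ennreal_mult''[symmetric] power2_eq_square intro!: ennreal_leI)
  qed
  also have "\<dots> = ennreal (4 * pi * v) * (\<integral>\<^sup>+s. ennreal (cut X (v + - 1 * s)) \<partial>lborel)"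
    by (rule nn_integral_cmult) simp
  also have "(\<integral>\<^sup>+s. ennreal (cut X (v + - 1 * s)) \<partial>lborel) = rint 0 X"
    using nn_integral_real_affine[where c="-1" and t=v and f="\<lambda>u. ennreal (cut X u)"]
    by (simp add: nn_integral_cut)
  finally show ?thesis .
qed

text \<open>\<open>z\<close> runs over the backward cone of (Y, c), and \<open>w\<close> over the
  future and past cones of the event (Y - dist c z, z). The inner integrals contribute X and Y -
  dist c z \<le> Y, a bound free of \<open>z\<close>, so the outer integral is that of
  \<open>nn_integral_radial_weight\<close>.\<close>

lemma nn_integral_double_cone:
  fixes c :: "real^3"
  assumes "X \<ge> 0" "Y \<ge> 0"
  shows "(\<integral>\<^sup>+z. (\<integral>\<^sup>+w. ennreal (G (Y - dist c z) / dist c z) *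
           (ennreal (cut X (Y - dist c z + dist z w) / dist z w) + ennreal (cut X (Y - dist c z - dist z w) / dist z w))
           \<partial>lborel) \<partial>lborel)
    \<le> ennreal (16 * pi\<^sup>2 * (X + Y)) * rint 0 X * rint 1 Y" (is "(\<integral>\<^sup>+z. ?I z \<partial>lborel) \<le> _")
proof -
  have inner: "?I z \<le> ennreal (4 * pi * (X + Y)) * rint 0 X * ennreal (G (Y - dist c z) / dist c z)" for z
  proof (cases "Y - dist c z \<ge> 0")
    case True
    have "(\<integral>\<^sup>+w. ennreal (cut X (Y - dist c z + dist z w) / dist z w) + ennreal (cut X (Y - dist c z - dist z w) / dist z w) \<partial>lborel)
      = (\<integral>\<^sup>+w. ennreal (cut X (Y - dist c z + dist z w) / dist z w) \<partial>lborel) + (\<integral>\<^sup>+w. ennreal (cut X (Y - dist c z - dist z w) / dist z w) \<partial>lborel)"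
      by (rule nn_integral_add) auto
    also have "\<dots> \<le> ennreal (4 * pi * X) * rint 0 X + ennreal (4 * pi * Y) * rint 0 X"
    proof (intro add_mono nn_integral_cone_plus True assms)
      have "(\<integral>\<^sup>+w. ennreal (cut X (Y - dist c z - dist z w) / dist z w) \<partial>lborel) \<le> ennreal (4 * pi * (Y - dist c z)) * rint 0 X"
        by (rule nn_integral_cone_minus[OF True assms(1)])
      also have "\<dots> \<le> ennreal (4 * pi * Y) * rint 0 X"
        by (intro mult_right_mono ennreal_leI mult_left_mono) auto
      finally show "(\<integral>\<^sup>+w. ennreal (cut X (Y - dist c z - dist z w) / dist z w) \<partial>lborel) \<le> ennreal (4 * pi * Y) * rint 0 X" .
    qed
    also have "\<dots> = ennreal (4 * pi * (X + Y)) * rint 0 X"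
      using assms by (simp add: distrib_left flip: distrib_right)
    finally show ?thesis
      by (subst nn_integral_cmult) (auto simp: mult.commute intro!: mult_left_mono)
  qed (simp add: neg)
  have "(\<integral>\<^sup>+z. ?I z \<partial>lborel) \<le> (\<integral>\<^sup>+z. ennreal (4 * pi * (X + Y)) * rint 0 X * ennreal (G (Y - dist c z) / dist c z) \<partial>lborel)"
    by (intro nn_integral_mono inner)
  also have "\<dots> = ennreal (4 * pi * (X + Y)) * rint 0 X * (ennreal (4 * pi) * rint 1 Y)"
    by (subst nn_integral_cmult) (auto simp: nn_integral_radial_weight)
  also have "\<dots> = (ennreal (4 * pi * (X + Y)) * ennreal (4 * pi)) * rint 0 X * rint 1 Y"
    by (simp add: mult_ac)
  also have "ennreal (4 * pi * (X + Y)) * ennreal (4 * pi) = ennreal (16 * pi\<^sup>2 * (X + Y))"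
    by (subst ennreal_mult''[symmetric]) (simp_all add: power2_eq_square mult_ac)
  finally show ?thesis .
qed

text \<open>The \<open>A0\<close> integrand without 1/|y'| and the second weight: \<beta> is |b|,
  \<open>X\<close> is x^0, \<open>u\<close> is cos \<vartheta>. With r = b2 / (2 (b0 + \<beta> u)),
  the factor |b2| / (4 (b0 + \<beta> u)^2) equals |dr/du| / (2 \<beta>).\<close>

definition cone_kernel :: "real \<Rightarrow> real \<Rightarrow> real \<Rightarrow> real \<Rightarrow> real \<Rightarrow> real" where
  "cone_kernel X \<beta> b0 b2 u =
     \<bar>b2\<bar> / (4 * (b0 + \<beta> * u)\<^sup>2) *
       ((if b2 > 0 \<and> b0 > 0 \<and> u > b2 / (2 * X * \<beta>) - b0 / \<beta> then 1 else 0)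
        + (if b2 < 0 \<and> u < b2 / (2 * X * \<beta>) - b0 / \<beta> then 1 else 0)) *
     G (X - b2 / (2 * (b0 + \<beta> * u)))"

lemma cone_kernel_nonneg [simp]: "cone_kernel X \<beta> b0 b2 u \<ge> 0"
  by (auto simp: cone_kernel_def)

lemma measurable_cone_kernel [measurable]: "cone_kernel X \<beta> b0 b2 \<in> borel_measurable borel"
  unfolding cone_kernel_def by measurable

text \<open>For X > 0 the denominator D takes the value b2 / (2 X) at the threshold, and on the
  support of the kernel it is further from 0 with the same sign. Hence r stays between 0 and X and
  is monotone in u, and the substitution yields at most the integral of \<open>G\<close> over
  [0, X].\<close>

lemma nn_integral_cone_kernel:
  assumes \<beta>: "\<beta> > 0" and X: "X \<ge> 0"
  shows "(\<integral>\<^sup>+u. ennreal (cone_kernel X \<beta> b0 b2 u) * indicator {-1..1} u \<partial>lborel) \<le> ennreal (1 / (2 * \<beta>)) * rint 0 X"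
    (is "?L \<le> ?R")
proof -
  define D where "D = (\<lambda>u. b0 + \<beta> * u)"
  define thr where "thr = b2 / (2 * X * \<beta>) - b0 / \<beta>"
  have D_mono: "u \<le> u' \<Longrightarrow> D u \<le> D u'" for u u'
    using \<beta> by (simp add: D_def)
  have Dthr: "D thr = b2 / (2 * X)"
    using \<beta> by (simp add: D_def thr_def field_simps)
  have K: "cone_kernel X \<beta> b0 b2 u = \<bar>b2\<bar> / (4 * (D u)\<^sup>2) *
       ((if b2 > 0 \<and> b0 > 0 \<and> u > thr then 1 else 0) + (if b2 < 0 \<and> u < thr then 1 else 0)) * G (X - b2 / (2 * D u))" for u
    by (simp add: cone_kernel_def D_def thr_def)
  show ?thesis
  proof (cases "X = 0")
    \<comment> \<open>With X = 0 the division convention turns the threshold into -b0 / \<beta>, the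
      zero of D. The sign conditions then make r positive, so the weight is evaluated at the
      negative time -r and vanishes.\<close>
    case True
    have "cone_kernel X \<beta> b0 b2 u = 0" for u
    proof -
      have "b2 / (2 * D u) > 0" if "b2 > 0 \<and> u > thr \<or> b2 < 0 \<and> u < thr"
      proof -
        have "u > thr \<longleftrightarrow> D u > 0" "u < thr \<longleftrightarrow> D u < 0"
          using \<beta> by (auto simp: D_def thr_def True field_simps)
        with that show ?thesis by (auto intro: divide_neg_neg)
      qed
      then show ?thesis unfolding K by (auto simp: True neg)
    qed
    then show ?thesis by simp
  next
    case False
    with X have X: "X > 0" by simp
    have der: "((\<lambda>u. b2 / (2 * D u)) has_real_derivative - (b2 * \<beta>) / (2 * (D u)\<^sup>2)) (at u)" if "D u \<noteq> 0" for u
    proof -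
      have D': "(D has_real_derivative \<beta>) (at u)"
        unfolding D_def by (auto intro!: derivative_eq_intros)
      show ?thesis
        using that by (auto intro!: derivative_eq_intros D' simp: power2_eq_square)
    qed
    show ?thesis
    proof (cases "b2 > 0")
      case b2: True
      \<comment> \<open>Left end of the support inside [-1, 1]. On [a, 1] the denominator D is at
        least b2 / (2 X) > 0, so X - r is smooth and increasing there.\<close>
      define a where "a = max (-1) thr"
      show ?thesis
      proof (cases "a \<le> 1")
        case False
        then have "ennreal (cone_kernel X \<beta> b0 b2 u) * indicator {-1..1} u = 0" for u
          using b2 unfolding K a_def by (auto simp: indicator_def)
        then have "?L = (\<integral>\<^sup>+(u::real). 0 \<partial>lborel)" by (simp only:)
        then show ?thesis by simp
      next
        case True
        have Da: "D u \<ge> b2 / (2 * X)" if "u \<ge> a" for u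
          using that D_mono[of thr u] Dthr by (auto simp: a_def)
        have Dpos: "D u > 0" if "u \<ge> a" for u
          using Da[OF that] X b2 by (meson divide_pos_pos less_le_trans mult_pos_pos zero_less_numeral)
        let ?g = "\<lambda>u. X - b2 / (2 * D u)"
        have "?L \<le> (\<integral>\<^sup>+u. ennreal (1 / (2 * \<beta>)) * (ennreal (G (?g u) * (b2 * \<beta> / (2 * (D u)\<^sup>2)) * indicator {a..1} u)) \<partial>lborel)"
        proof (rule nn_integral_mono)
          fix u
          show "ennreal (cone_kernel X \<beta> b0 b2 u) * indicator {-1..1} u \<le>
             ennreal (1 / (2 * \<beta>)) * (ennreal (G (?g u) * (b2 * \<beta> / (2 * (D u)\<^sup>2)) * indicator {a..1} u))"
          proof (cases "u \<in> {-1..1} \<and> u > thr")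
            case True
            have "1 / (2 * \<beta>) * (G (?g u) * (b2 * \<beta> / (2 * (D u)\<^sup>2))) = b2 / (4 * (D u)\<^sup>2) * G (?g u)"
              using \<beta> by simp
            moreover have "cone_kernel X \<beta> b0 b2 u \<le> b2 / (4 * (D u)\<^sup>2) * G (?g u)"
              using b2 unfolding K by simp
            ultimately show ?thesis
              using True \<beta> by (simp add: a_def ennreal_mult'[symmetric] ennreal_leI mult.commute)
          next
            case False
            then show ?thesis using b2 unfolding K by auto
          qed
        qed
        also have "\<dots> = ennreal (1 / (2 * \<beta>)) * (\<integral>\<^sup>+u. ennreal (G (?g u) * (b2 * \<beta> / (2 * (D u)\<^sup>2)) * indicator {a..1} u) \<partial>lborel)"
          unfolding D_def by (rule nn_integral_cmult) measurable
        also have "(\<integral>\<^sup>+u. ennreal (G (?g u) * (b2 * \<beta> / (2 * (D u)\<^sup>2)) * indicator {a..1} u) \<partial>lborel)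
            = (\<integral>\<^sup>+s. ennreal (G s * indicator {?g a..?g 1} s) \<partial>lborel)"
        proof (rule nn_integral_substitution[symmetric])
          show "set_borel_measurable borel {?g a..?g 1} G"
            unfolding set_borel_measurable_def by measurable
          show "(?g has_real_derivative b2 * \<beta> / (2 * (D u)\<^sup>2)) (at u)" if "u \<in> {a..1}" for u
            using that Dpos[of u] DERIV_diff[OF DERIV_const der[of u], of X] by simp
          show "continuous_on {a..1} (\<lambda>u. b2 * \<beta> / (2 * (D u)\<^sup>2))"
            using Dpos unfolding D_def by (force intro!: continuous_intros)
          show "0 \<le> b2 * \<beta> / (2 * (D u)\<^sup>2)" for u using b2 \<beta> by simp
        qed (fact True)
        also have "\<dots> \<le> rint 0 X"
          unfolding rint_def
        proof (rule nn_integral_mono)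
          fix s
          have "?g a \<ge> 0"
            using Da[of a] Dpos[of a] X by (simp add: field_simps)
          moreover have "?g 1 \<le> X" using Dpos[of 1] True b2 by simp
          ultimately show "ennreal (G s * indicator {?g a..?g 1} s) \<le> ennreal ((X - s) ^ 0 * G s) * indicator {0..X} s"
            by (auto simp: indicator_def)
        qed
        finally show ?thesis by (simp add: mult_left_mono)
      qed
    next
      case nb2: False
      show ?thesis
      proof (cases "b2 < 0")
        case False
        with nb2 have "cone_kernel X \<beta> b0 b2 u = 0" for u unfolding K by simp
        then show ?thesis by simp
      next
        case b2: True
        \<comment> \<open>For b2 < 0 the support lies to the left of the threshold, where D is
          negative.\<close>
        define a where "a = min 1 thr"
        show ?thesis
        proof (cases "-1 \<le> a")
          case False
          then have "ennreal (cone_kernel X \<beta> b0 b2 u) * indicator {-1..1} u = 0" for u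
            using b2 unfolding K a_def by (auto simp: indicator_def)
          then have "?L = (\<integral>\<^sup>+(u::real). 0 \<partial>lborel)" by (simp only:)
          then show ?thesis by simp
        next
          case True
          have Da: "D u \<le> b2 / (2 * X)" if "u \<le> a" for u
            using that D_mono[of u thr] Dthr by (auto simp: a_def)
          have Dneg: "D u < 0" if "u \<le> a" for u
            using Da[OF that] X b2 by (meson divide_neg_pos le_less_trans mult_pos_pos zero_less_numeral)
          \<comment> \<open>Now r itself increases with u, so r is the new variable and the
            reflected form of \<open>rint 0 X\<close> is the one that appears.\<close>
          let ?g = "\<lambda>u. b2 / (2 * D u)"
          have "?L \<le> (\<integral>\<^sup>+u. ennreal (1 / (2 * \<beta>)) * (ennreal (G (X - ?g u) * (- (b2 * \<beta>) / (2 * (D u)\<^sup>2)) * indicator {-1..a} u)) \<partial>lborel)"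
          proof (rule nn_integral_mono)
            fix u
            show "ennreal (cone_kernel X \<beta> b0 b2 u) * indicator {-1..1} u \<le>
               ennreal (1 / (2 * \<beta>)) * (ennreal (G (X - ?g u) * (- (b2 * \<beta>) / (2 * (D u)\<^sup>2)) * indicator {-1..a} u))"
            proof (cases "u \<in> {-1..1} \<and> u < thr")
              case True
              have "1 / (2 * \<beta>) * (G (X - ?g u) * (- (b2 * \<beta>) / (2 * (D u)\<^sup>2))) = - b2 / (4 * (D u)\<^sup>2) * G (X - ?g u)"
                using \<beta> by simp
              moreover have "cone_kernel X \<beta> b0 b2 u \<le> - b2 / (4 * (D u)\<^sup>2) * G (X - ?g u)"
                using True b2 unfolding K by simp
              ultimately show ?thesis
                using True \<beta> by (simp add: a_def ennreal_mult'[symmetric] ennreal_leI mult.commute)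
            next
              case False
              then show ?thesis using b2 unfolding K by auto
            qed
          qed
          also have "\<dots> = ennreal (1 / (2 * \<beta>)) * (\<integral>\<^sup>+u. ennreal (G (X - ?g u) * (- (b2 * \<beta>) / (2 * (D u)\<^sup>2)) * indicator {-1..a} u) \<partial>lborel)"
            unfolding D_def by (rule nn_integral_cmult) measurable
          also have "(\<integral>\<^sup>+u. ennreal (G (X - ?g u) * (- (b2 * \<beta>) / (2 * (D u)\<^sup>2)) * indicator {-1..a} u) \<partial>lborel)
              = (\<integral>\<^sup>+s. ennreal (G (X - s) * indicator {?g (-1)..?g a} s) \<partial>lborel)"
          proof (rule nn_integral_substitution[symmetric, where f="\<lambda>s. G (X - s)"])
            show "set_borel_measurable borel {?g (-1)..?g a} (\<lambda>s. G (X - s))"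
              unfolding set_borel_measurable_def by measurable
            show "(?g has_real_derivative - (b2 * \<beta>) / (2 * (D u)\<^sup>2)) (at u)" if "u \<in> {-1..a}" for u
              using that Dneg[of u] der[of u] by simp
            show "continuous_on {-1..a} (\<lambda>u. - (b2 * \<beta>) / (2 * (D u)\<^sup>2))"
              using Dneg unfolding D_def by (force intro!: continuous_intros)
            show "0 \<le> - (b2 * \<beta>) / (2 * (D u)\<^sup>2)" for u
              using b2 \<beta> mult_neg_pos[OF b2 \<beta>] by (intro divide_nonneg_nonneg) auto
          qed (fact True)
          also have "\<dots> \<le> rint 0 X"
            unfolding rint_0_reflect[symmetric]
          proof (rule nn_integral_mono)
            fix s
            have "?g a \<le> X"
              using Da[of a] Dneg[of a] X by (simp add: field_simps)
            moreover have "?g (-1) \<ge> 0" using Dneg[of "-1"] True b2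
              by (simp add: divide_nonpos_neg)
            ultimately show "ennreal (G (X - s) * indicator {?g (-1)..?g a} s) \<le> ennreal (G (X - s)) * indicator {0..X} s"
              by (auto simp: indicator_def)
          qed
          finally show ?thesis by (simp add: mult_left_mono)
        qed
      qed
    qed
  qed
qed

end

section \<open>Iterated integrals of the weight\<close>

text \<open>The bridge from nonnegative Lebesgue integrals to the gauge integral in which
  \<open>giter\<close> is defined; finiteness excludes the default value of a nonexistent gauge
  integral.\<close>

lemma nn_integral_Icc_eq_integral:
  fixes f :: "real \<Rightarrow> real"
  assumes [measurable]: "f \<in> borel_measurable borel" and nonneg: "\<And>u. u \<in> {0..t} \<Longrightarrow> f u \<ge> 0"
    and fin: "(\<integral>\<^sup>+u. ennreal (f u) * indicator {0..t} u \<partial>lborel) \<noteq> \<infinity>"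
  shows "(\<integral>\<^sup>+u. ennreal (f u) * indicator {0..t} u \<partial>lborel) = ennreal (integral {0..t} f)"
    and "integral {0..t} f \<ge> 0"
proof -
  obtain r where r: "r \<ge> 0" "(\<integral>\<^sup>+u. ennreal (f u) * indicator {0..t} u \<partial>lborel) = ennreal r"
    using fin by (metis ennreal_cases infinity_ennreal_def)
  have "(\<integral>\<^sup>+u. ennreal (if u \<in> {0..t} then f u else 0) \<partial>lborel) = ennreal r"
    unfolding r(2)[symmetric] by (rule nn_integral_cong) auto
  then have "((\<lambda>u. if u \<in> {0..t} then f u else 0) has_integral r) UNIV"
    using nonneg r(1) by (intro nn_integral_has_integral) auto
  then have "(f has_integral r) {0..t}" by (simp only: has_integral_restrict_UNIV)
  then have "integral {0..t} f = r" by (rule integral_unique)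
  then show "(\<integral>\<^sup>+u. ennreal (f u) * indicator {0..t} u \<partial>lborel) = ennreal (integral {0..t} f)"
    "integral {0..t} f \<ge> 0" using r by simp_all
qed

context weight
begin

lemma rint_finite: "rint n t \<noteq> \<infinity>"
proof -
  have "rint n t \<le> (\<integral>\<^sup>+u. ennreal (t ^ n * G t) * indicator {0..t} u \<partial>lborel)"
    unfolding rint_def
  proof (rule nn_integral_mono)
    fix u
    show "ennreal ((t - u) ^ n * G u) * indicator {0..t} u \<le> ennreal (t ^ n * G t) * indicator {0..t} u"
      by (auto simp: indicator_def intro!: ennreal_leI mult_mono power_mono monoD[OF mono])
  qed
  also have "\<dots> < \<infinity>"
    by (subst nn_integral_cmult_indicator) (auto simp: ennreal_mult_less_top emeasure_lborel_Icc_eq)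
  finally show ?thesis by simp
qed

lemma measurable_rint [measurable]: "rint n \<in> borel_measurable borel"
proof -
  have "rint n = (\<lambda>t. \<integral>\<^sup>+u. ennreal ((t - u) ^ n * G u) * (if 0 \<le> u \<and> u \<le> t then 1 else 0) \<partial>lborel)"
    unfolding rint_def by (intro ext nn_integral_cong) (auto simp: indicator_def)
  also have "\<dots> \<in> borel_measurable borel" by measurable
  finally show ?thesis .
qed

text \<open>Fubini over the triangle 0 \<le> u \<le> s \<le> t: integrating (s - u)^n over s from u
  to t gives (t - u)^(n+1) / (n+1), and \<open>Suc n\<close> clears the denominator.\<close>

lemma rint_Suc: "rint (Suc n) t = ennreal (Suc n) * (\<integral>\<^sup>+s. rint n s * indicator {0..t} s \<partial>lborel)"
proof -
  have "(\<integral>\<^sup>+s. rint n s * indicator {0..t} s \<partial>lborel)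
     = (\<integral>\<^sup>+s. (\<integral>\<^sup>+u. ennreal ((s - u) ^ n * G u) * (if 0 \<le> u \<and> u \<le> s \<and> s \<le> t then 1 else 0) \<partial>lborel) \<partial>lborel)"
  proof (rule nn_integral_cong)
    fix s
    have "rint n s * indicator {0..t} s
        = (\<integral>\<^sup>+u. ennreal ((s - u) ^ n * G u) * indicator {0..s} u * indicator {0..t} s \<partial>lborel)"
      unfolding rint_def by (rule nn_integral_multc[symmetric]) measurable
    also have "\<dots> = (\<integral>\<^sup>+u. ennreal ((s - u) ^ n * G u) * (if 0 \<le> u \<and> u \<le> s \<and> s \<le> t then 1 else 0) \<partial>lborel)"
      by (rule nn_integral_cong) (auto simp: indicator_def)
    finally show "rint n s * indicator {0..t} s = \<dots>" .
  qed
  also have "\<dots> = (\<integral>\<^sup>+u. (\<integral>\<^sup>+s. ennreal ((s - u) ^ n * G u) * (if 0 \<le> u \<and> u \<le> s \<and> s \<le> t then 1 else 0) \<partial>lborel) \<partial>lborel)"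
    by (rule lborel_pair.Fubini') measurable
  also have "\<dots> = (\<integral>\<^sup>+u. ennreal (1 / Suc n) * (ennreal ((t - u) ^ Suc n * G u) * indicator {0..t} u) \<partial>lborel)"
  proof (rule nn_integral_cong)
    fix u
    show "(\<integral>\<^sup>+s. ennreal ((s - u) ^ n * G u) * (if 0 \<le> u \<and> u \<le> s \<and> s \<le> t then 1 else 0) \<partial>lborel)
      = ennreal (1 / Suc n) * (ennreal ((t - u) ^ Suc n * G u) * indicator {0..t} u)"
    proof (cases "0 \<le> u \<and> u \<le> t")
      case True
      have "(\<integral>\<^sup>+s. ennreal ((s - u) ^ n * G u) * (if 0 \<le> u \<and> u \<le> s \<and> s \<le> t then 1 else 0) \<partial>lborel)
        = (\<integral>\<^sup>+s. ennreal ((s - u) ^ n * G u) * indicator {u..t} s \<partial>lborel)"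
        using True by (intro nn_integral_cong) (auto simp: indicator_def)
      also have "\<dots> = ennreal ((t - u) ^ Suc n / Suc n * G u - (u - u) ^ Suc n / Suc n * G u)"
        using True
        by (intro nn_integral_FTC_Icc)
           (auto intro!: derivative_eq_intros simp del: power_Suc of_nat_Suc)
      also have "\<dots> = ennreal (1 / Suc n) * ennreal ((t - u) ^ Suc n * G u)"
        using True by (subst ennreal_mult'[symmetric]) (auto simp del: of_nat_Suc)
      finally show ?thesis using True by simp
    next
      case False
      then have "(if 0 \<le> u \<and> u \<le> s \<and> s \<le> t then 1 else 0) = (0::ennreal)" for s by auto
      with False show ?thesis by simp
    qed
  qed
  also have "\<dots> = ennreal (1 / Suc n) * rint (Suc n) t"
    unfolding rint_def by (rule nn_integral_cmult) measurable
  finally have "ennreal (Suc n) * (\<integral>\<^sup>+s. rint n s * indicator {0..t} s \<partial>lborel)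
      = (ennreal (Suc n) * ennreal (1 / Suc n)) * rint (Suc n) t"
    by (simp only: mult.assoc)
  also have "ennreal (Suc n) * ennreal (1 / Suc n) = 1"
    by (subst ennreal_mult'[symmetric]) (simp_all del: of_nat_Suc)
  finally show ?thesis by simp
qed

text \<open>\<open>g\<close> and \<open>G\<close> are compared at positive times only, since the
  value at the single point 0 does not affect an integral. Nonnegativity is carried along because
  \<open>ennreal\<close> sends negative numbers to 0.\<close>

lemma giter_eq_rint:
  assumes g: "\<And>t. t > 0 \<Longrightarrow> g t = G t" and "t \<ge> 0"
  shows "giter g (Suc n) t \<ge> 0 \<and> rint n t = ennreal (fact n * giter g (Suc n) t)"
  using assms(2)
proof (induction n arbitrary: t)
  case 0
  have I: "rint 0 t = (\<integral>\<^sup>+u. ennreal (G u) * indicator {0..t} u \<partial>lborel)"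
    by (simp add: rint_def)
  have "integral {0..t} g = integral {0..t} G"
    by (rule integral_spike[of "{0}"]) (auto simp: g)
  then show ?case
    using nn_integral_Icc_eq_integral[of G t] rint_finite[of 0 t] I by simp
next
  case (Suc n)
  \<comment> \<open>A formula for the (n+1)-fold integral that is measurable and nonnegative on the
    whole line and agrees with \<open>giter\<close> at nonnegative times.\<close>
  let ?f = "\<lambda>s. enn2real (rint n s) / fact n"
  have eq: "giter g (Suc n) s = ?f s" if "s \<ge> 0" for s
    using Suc.IH[OF that] by simp
  have int: "giter g (Suc (Suc n)) t = integral {0..t} ?f"
    using Suc.prems eq by (subst giter.simps(2)) (intro integral_cong, auto simp del: giter.simps)
  have "ennreal (1 / fact n) * (\<integral>\<^sup>+s. rint n s * indicator {0..t} s \<partial>lborel)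
      = (\<integral>\<^sup>+s. ennreal (1 / fact n) * (rint n s * indicator {0..t} s) \<partial>lborel)"
    by (rule nn_integral_cmult[symmetric]) measurable
  also have "\<dots> = (\<integral>\<^sup>+s. ennreal (?f s) * indicator {0..t} s \<partial>lborel)"
  proof (rule nn_integral_cong)
    fix s
    have "ennreal (?f s) = ennreal (1 / fact n) * rint n s"
      using rint_finite[of n s] by (cases "rint n s") (auto simp: ennreal_mult''[symmetric])
    then show "ennreal (1 / fact n) * (rint n s * indicator {0..t} s) = ennreal (?f s) * indicator {0..t} s"
      by (simp add: mult.assoc)
  qed
  finally have J: "(\<integral>\<^sup>+s. ennreal (?f s) * indicator {0..t} s \<partial>lborel)
      = ennreal (1 / fact n) * (\<integral>\<^sup>+s. rint n s * indicator {0..t} s \<partial>lborel)" by simp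
  have "(\<integral>\<^sup>+s. rint n s * indicator {0..t} s \<partial>lborel) \<noteq> \<infinity>"
    using rint_finite[of "Suc n" t] unfolding rint_Suc by (auto simp: ennreal_mult_eq_top_iff)
  with J have fin: "(\<integral>\<^sup>+s. ennreal (?f s) * indicator {0..t} s \<partial>lborel) \<noteq> \<infinity>"
    by (auto simp: ennreal_mult_eq_top_iff)
  have K: "(\<integral>\<^sup>+s. ennreal (?f s) * indicator {0..t} s \<partial>lborel) = ennreal (integral {0..t} ?f)"
    "integral {0..t} ?f \<ge> 0"
    by (rule nn_integral_Icc_eq_integral[OF _ _ fin]; simp)+
  have "rint (Suc n) t = ennreal (Suc n) * (\<integral>\<^sup>+s. rint n s * indicator {0..t} s \<partial>lborel)"
    by (rule rint_Suc)
  also have "\<dots> = (ennreal (fact (Suc n)) * ennreal (1 / fact n)) * (\<integral>\<^sup>+s. rint n s * indicator {0..t} s \<partial>lborel)"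
    by (subst ennreal_mult'[symmetric]) (simp_all)
  also have "\<dots> = ennreal (fact (Suc n)) * ennreal (integral {0..t} ?f)"
    by (simp only: mult.assoc J[symmetric] K)
  also have "\<dots> = ennreal (fact (Suc n) * giter g (Suc (Suc n)) t)"
    using K(2) unfolding int by (subst ennreal_mult) auto
  finally show ?case using K(2) unfolding int by simp
qed

end

text \<open>By monotonicity the infimum is the right limit at 0. It may exceed \<open>g 0\<close>,
  and time 0 is a null set, so the essential supremum controls \<psi> there only through this limit.
  The value 0 at negative times matches the extension of \<psi> by 0.\<close>

definition weight_ext :: "(real \<Rightarrow> real) \<Rightarrow> real \<Rightarrow> real" where
  "weight_ext g t = (if t < 0 then 0 else if t = 0 then Inf (g ` {0<..}) else g t)"

lemma weight_weight_ext:
  assumes pos: "\<forall>t\<ge>0. g t > 0" and mono: "mono_on {0..} g"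
  shows "weight (weight_ext g)"
proof
  have bdd: "bdd_below (g ` {0<..})" using pos by (auto intro!: bdd_belowI[of _ 0] simp: less_imp_le)
  have Inf_le: "Inf (g ` {0<..}) \<le> g t" if "t > 0" for t
    using that bdd by (intro cINF_lower) auto
  have Inf_ge: "Inf (g ` {0<..}) \<ge> 0"
    using pos by (intro cINF_greatest) (auto simp: less_imp_le)
  show "mono (weight_ext g)"
  proof (rule monoI)
    fix s t :: real assume "s \<le> t"
    moreover have "g s \<le> g t" if "0 < s" using that \<open>s \<le> t\<close> by (intro mono_onD[OF mono]) auto
    ultimately show "weight_ext g s \<le> weight_ext g t"
      using Inf_le[of t] Inf_ge pos by (auto simp: weight_ext_def less_imp_le)
  qed
qed (simp add: weight_ext_def)

section \<open>The weighted norm\<close>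

text \<open>Nonempty open sets are not null, so an almost everywhere property has a witness in each
  of them.\<close>

lemma AE_lborel_open_ex:
  fixes U :: "'a::euclidean_space set"
  assumes "AE x in lborel. P x" "open U" "U \<noteq> {}"
  shows "\<exists>x\<in>U. P x"
proof (rule ccontr)
  assume c: "\<not> (\<exists>x\<in>U. P x)"
  obtain N where N: "{x \<in> space lborel. \<not> P x} \<subseteq> N" "emeasure lborel N = 0" "N \<in> sets lborel"
    using AE_E[OF assms(1)] by blast
  then have "negligible N"
    by (simp add: negligible_iff_null_sets null_sets_completionI null_setsI)
  moreover have "U \<subseteq> N" using N(1) c by auto
  ultimately have "negligible U" by (rule negligible_subset)
  with open_not_negligible[OF assms(2,3)] show False by simp
qed

lemma schwartz_imp_continuous: "schwartz f \<Longrightarrow> continuous_on UNIV f"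
  unfolding schwartz_def
  by (metis iter_dd.simps(1) differentiable_imp_continuous_within continuous_at_imp_continuous_on)

lemma schwartz_imp_bounded:
  assumes "schwartz f" obtains K where "\<And>x. norm (f x) \<le> K"
proof -
  have "\<forall>vs (k::nat). bdd_above (range (\<lambda>x. (1 + norm x) ^ k * norm (iter_dd vs f x)))"
    using assms unfolding schwartz_def by (rule conjunct2)
  from this[rule_format, of 0 "[]"] obtain K where "\<And>x. norm (f x) \<le> K" by (auto simp: bdd_above_def)
  then show ?thesis by (rule that)
qed

lemma closed_halfM2: "closed (halfM \<times> halfM)"
proof -
  have "closed {x :: mpoint. 0 \<le> fst x}"
    by (intro closed_Collect_le continuous_intros)
  then show ?thesis unfolding halfM_def by (intro closed_Times)
qed

lemma schwartz_half_measurable: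
  assumes "\<psi> \<in> schwartz_half"
  shows "(\<lambda>p. \<psi> (fst p) (snd p)) \<in> borel_measurable borel"
proof -
  obtain \<Psi> where S: "schwartz \<Psi>" and eq: "\<And>x y. x \<in> halfM \<Longrightarrow> y \<in> halfM \<Longrightarrow> \<psi> x y = \<Psi> (x, y)"
    and z: "\<And>x y. \<not> (x \<in> halfM \<and> y \<in> halfM) \<Longrightarrow> \<psi> x y = 0"
    using assms unfolding schwartz_half_def by blast
  have [measurable]: "\<Psi> \<in> borel_measurable borel"
    using schwartz_imp_continuous[OF S] by (rule borel_measurable_continuous_onI)
  have [measurable]: "halfM \<times> halfM \<in> sets borel"
    using closed_halfM2 by (rule borel_closed)
  have "(\<lambda>p. \<psi> (fst p) (snd p)) = (\<lambda>p. if p \<in> halfM \<times> halfM then \<Psi> p else 0)"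
    by (auto simp: fun_eq_iff eq z mem_Times_iff)
  then show ?thesis by simp
qed

text \<open>\<open>esssup_I\<close> asks for measurability. Since \<open>g\<close> is monotone only
  on the half-line, it is replaced by \<open>g (max 0 t)\<close>, which is monotone everywhere and
  agrees with it on the domain.\<close>

lemma gnorm_integrand_measurable:
  assumes [measurable]: "(\<lambda>p. \<phi> (fst p) (snd p)) \<in> borel_measurable borel" and mono: "mono_on {0..} g"
  shows "(\<lambda>(x, y). ereal (cmod (\<phi> x y) / (g (fst x) * g (fst y))))
    \<in> borel_measurable (restrict_space lborel (halfM \<times> halfM))"
proof -
  define h where "h = (\<lambda>t. g (max 0 t))"
  have "mono h" unfolding h_def by (intro monoI mono_onD[OF mono]) auto
  then have [measurable]: "h \<in> borel_measurable borel" by (rule borel_measurable_mono)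
  have "(\<lambda>p. ereal (cmod (\<phi> (fst p) (snd p)) / (h (fst (fst p)) * h (fst (snd p)))))
    \<in> borel_measurable (restrict_space lborel (halfM \<times> halfM))"
    by (intro measurable_restrict_space1) measurable
  also have "?this \<longleftrightarrow> ?thesis"
    by (rule measurable_cong) (auto simp: space_restrict_space h_def halfM_def case_prod_unfold)
  finally show ?thesis .
qed

lemma gnorm_le:
  assumes "(\<lambda>p. \<phi> (fst p) (snd p)) \<in> borel_measurable borel" "mono_on {0..} g"
    and "\<And>x y. fst x \<ge> 0 \<Longrightarrow> fst y \<ge> 0 \<Longrightarrow> ereal (cmod (\<phi> x y) / (g (fst x) * g (fst y))) \<le> C"
  shows "gnorm g \<phi> \<le> C"
  unfolding gnorm_def
proof (intro esssup_I gnorm_integrand_measurable assms(1,2) AE_I2)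
  fix p assume "p \<in> space (restrict_space lborel (halfM \<times> halfM))"
  then show "(case p of (x, y) \<Rightarrow> ereal (cmod (\<phi> x y) / (g (fst x) * g (fst y)))) \<le> C"
    using assms(3)[of "fst p" "snd p"]
    by (auto simp: space_restrict_space halfM_def case_prod_unfold mem_Times_iff)
qed

text \<open>A violation at one point would, by continuity, spread to an open set of points with
  positive times, which the almost everywhere bound forbids. The norm is shown positive and finite
  as well, because the operator quotient divides by it.\<close>

lemma schwartz_half_weight_bound:
  assumes \<psi>: "\<psi> \<in> schwartz_half" "\<psi> \<noteq> (\<lambda>_ _. 0)"
    and pos: "\<forall>t\<ge>0. g t > 0" and mono: "mono_on {0..} g"
    and bdd: "bdd_above ((\<lambda>t. 1 / g t) ` {0..})"
  obtains \<nu> where "\<nu> > 0" "gnorm g \<psi> = ereal \<nu>"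
    "\<And>x y. cmod (\<psi> x y) \<le> \<nu> * weight_ext g (fst x) * weight_ext g (fst y)"
proof -
  obtain \<Psi> where S: "schwartz \<Psi>" and eq: "\<And>x y. x \<in> halfM \<Longrightarrow> y \<in> halfM \<Longrightarrow> \<psi> x y = \<Psi> (x, y)"
    and z: "\<And>x y. \<not> (x \<in> halfM \<and> y \<in> halfM) \<Longrightarrow> \<psi> x y = 0"
    using \<psi>(1) unfolding schwartz_half_def by blast
  have cont: "continuous_on UNIV (\<lambda>p. cmod (\<Psi> p))"
    using schwartz_imp_continuous[OF S] by (intro continuous_intros)
  let ?f = "\<lambda>(x, y). ereal (cmod (\<psi> x y) / (g (fst x) * g (fst y)))"
  have AE: "AE p in lborel. p \<in> halfM \<times> halfM \<longrightarrow> ?f p \<le> gnorm g \<psi>"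
  proof -
    have "AE p in restrict_space lborel (halfM \<times> halfM). ?f p \<le> gnorm g \<psi>"
      unfolding gnorm_def by (rule esssup_AE)
    then show ?thesis
      by (subst (asm) AE_restrict_space_iff) (use closed_halfM2 borel_closed in auto)
  qed
  obtain K where K: "\<And>p. cmod (\<Psi> p) \<le> K" using schwartz_imp_bounded[OF S] by blast
  have K0: "K \<ge> 0" using order_trans[OF norm_ge_zero K] .
  obtain L where L: "\<And>t. t \<ge> 0 \<Longrightarrow> 1 / g t \<le> L" using bdd by (auto simp: bdd_above_def)
  \<comment> \<open>Finite because both \<psi> and 1/g are bounded; each of the two denominators
    contributes a factor \<open>L\<close>.\<close>
  have upper: "gnorm g \<psi> \<le> ereal (K * L * L)"
  proof (rule gnorm_le[OF schwartz_half_measurable[OF \<psi>(1)] mono])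
    fix x y :: mpoint assume xy: "fst x \<ge> 0" "fst y \<ge> 0"
    have "cmod (\<psi> x y) / (g (fst x) * g (fst y)) = cmod (\<psi> x y) * (1 / g (fst x)) * (1 / g (fst y))" by simp
    also have "\<dots> \<le> K * L * L"
      using xy pos K K0 order_trans[OF _ L[of 0]]
      by (intro mult_mono L) (auto simp: eq halfM_def less_imp_le intro!: mult_nonneg_nonneg)
    finally show "ereal (cmod (\<psi> x y) / (g (fst x) * g (fst y))) \<le> ereal (K * L * L)" by simp
  qed
  have lower: "gnorm g \<psi> \<ge> 0"
  proof -
    have "open {p :: mpoint \<times> mpoint. 0 < fst (fst p) \<and> 0 < fst (snd p)}"
      by (intro open_Collect_conj open_Collect_less continuous_intros)
    moreover have "((1, 0), (1, 0)) \<in> {p :: mpoint \<times> mpoint. 0 < fst (fst p) \<and> 0 < fst (snd p)}" by simp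
    ultimately obtain p where "p \<in> {p :: mpoint \<times> mpoint. 0 < fst (fst p) \<and> 0 < fst (snd p)}"
      "p \<in> halfM \<times> halfM \<longrightarrow> ?f p \<le> gnorm g \<psi>"
      using AE_lborel_open_ex[OF AE, of "{p. 0 < fst (fst p) \<and> 0 < fst (snd p)}"] by blast
    then have "?f p \<le> gnorm g \<psi>" "?f p \<ge> 0"
      using pos by (auto simp: halfM_def mem_Times_iff case_prod_unfold less_imp_le)
    then show ?thesis by (rule order_trans[rotated])
  qed
  obtain \<nu> where \<nu>: "gnorm g \<psi> = ereal \<nu>" "\<nu> \<ge> 0"
    using upper lower by (cases "gnorm g \<psi>") auto
  \<comment> \<open>\<open>s\<close> and \<open>s'\<close> are positive upper bounds of the two
    times. They leave room to move off the boundary, and monotonicity of \<open>g\<close> absorbs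
    the displacement as long as the new times stay below them.\<close>
  have bound: "cmod (\<psi> x y) \<le> \<nu> * (g s * g s')"
    if xy: "0 \<le> fst x" "0 \<le> fst y" and s: "fst x \<le> s" "0 < s" "fst y \<le> s'" "0 < s'" for x y s s'
  proof (rule ccontr)
    assume c: "\<not> ?thesis"
    define U where "U = {p. cmod (\<Psi> p) > \<nu> * (g s * g s')} \<inter>
       {p :: mpoint \<times> mpoint. 0 < fst (fst p) \<and> fst (fst p) < s \<and> 0 < fst (snd p) \<and> fst (snd p) < s'}"
    have o: "open {p. cmod (\<Psi> p) > \<nu> * (g s * g s')}"
      by (intro open_Collect_less cont continuous_intros)
    have "open U" unfolding U_def
      by (intro open_Int o open_Collect_conj open_Collect_less continuous_intros)
    moreover have "U \<noteq> {}"
    proof -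
      have "(x, y) \<in> {p. cmod (\<Psi> p) > \<nu> * (g s * g s')}"
        using c eq[of x y] xy by (auto simp: halfM_def)
      then obtain e where e: "e > 0" "ball (x, y) e \<subseteq> {p. cmod (\<Psi> p) > \<nu> * (g s * g s')}"
        using o open_contains_ball by blast
      \<comment> \<open>Moves a time \<open>a\<close> into the open interval (0, b): upwards if a =
        0, otherwise downwards, since a = b is possible. Two displacements below e / 2 keep the
        point in the ball.\<close>
      have approx: "\<exists>t. 0 < t \<and> t < b \<and> \<bar>t - a\<bar> < e / 2" if "0 \<le> a" "a \<le> b" "0 < b" for a b :: real
      proof (cases "a = 0")
        case True
        then show ?thesis using that e(1) by (intro exI[of _ "min b e / 4"]) (auto simp: min_def)
      next
        case False
        then show ?thesis using that e(1) by (intro exI[of _ "a - min a e / 4"]) (auto simp: min_def)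
      qed
      obtain t where t: "0 < t" "t < s" "\<bar>t - fst x\<bar> < e / 2" using approx xy s by blast
      obtain t' where t': "0 < t'" "t' < s'" "\<bar>t' - fst y\<bar> < e / 2" using approx xy s by blast
      have "dist ((t, snd x), (t', snd y)) (x, y) \<le> \<bar>t - fst x\<bar> + \<bar>t' - fst y\<bar>"
        unfolding dist_prod_def by (simp add: dist_real_def sqrt_sum_squares_le_sum_abs)
      also have "\<dots> < e" using t t' by simp
      finally have "((t, snd x), (t', snd y)) \<in> ball (x, y) e" by (simp add: dist_commute)
      with e(2) have "((t, snd x), (t', snd y)) \<in> U"
        using t t' unfolding U_def by (intro IntI subsetD[OF e(2)]) auto
      then show ?thesis by auto
    qed
    ultimately obtain p where p: "p \<in> U" "p \<in> halfM \<times> halfM \<longrightarrow> ?f p \<le> gnorm g \<psi>"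
      using AE_lborel_open_ex[OF AE] by blast
    obtain x' y' where p': "p = (x', y')" by (cases p)
    have q: "0 < fst x'" "fst x' < s" "0 < fst y'" "fst y' < s'" and big: "cmod (\<Psi> (x', y')) > \<nu> * (g s * g s')"
      using p(1) by (auto simp: U_def p')
    have "cmod (\<psi> x' y') / (g (fst x') * g (fst y')) \<le> \<nu>"
      using p(2) q by (simp add: p' halfM_def \<nu>)
    then have "cmod (\<psi> x' y') \<le> \<nu> * (g (fst x') * g (fst y'))"
      using pos q by (simp add: pos_divide_le_eq)
    also have "\<dots> \<le> \<nu> * (g s * g s')"
      using q \<nu> pos by (intro mult_left_mono mult_mono mono_onD[OF mono]) (auto simp: less_imp_le)
    finally show False using big eq[of x' y'] q by (auto simp: halfM_def)
  qed
  have "\<nu> \<noteq> 0"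
  proof
    assume "\<nu> = 0"
    have "\<psi> x y = 0" for x y
    proof (cases "x \<in> halfM \<and> y \<in> halfM")
      case True
      then have "cmod (\<psi> x y) \<le> \<nu> * (g (fst x + 1) * g (fst y + 1))"
        by (intro bound) (auto simp: halfM_def)
      then show ?thesis using \<open>\<nu> = 0\<close> by simp
    qed (simp add: z)
    then show False using \<psi>(2) by (auto simp: fun_eq_iff)
  qed
  with \<nu>(2) have \<nu>0: "\<nu> > 0" by simp
  \<comment> \<open>Passage to the infimum over s: for t > 0 the choice s = t suffices, and at t = 0
    the infimum is the value of \<open>weight_ext\<close> by definition.\<close>
  have le_weight: "c \<le> a * weight_ext g t" if "a > 0" "t \<ge> 0" "\<And>s. t \<le> s \<Longrightarrow> 0 < s \<Longrightarrow> c \<le> a * g s" for a c t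
  proof (cases "t = 0")
    case True
    have "c / a \<le> Inf (g ` {0<..})"
      using that True by (intro cINF_greatest) (auto simp: pos_divide_le_eq mult.commute)
    then show ?thesis using that(1) True by (simp add: weight_ext_def pos_divide_le_eq mult.commute)
  qed (use that in \<open>auto simp: weight_ext_def\<close>)
  interpret weight "weight_ext g" by (rule weight_weight_ext[OF pos mono])
  have "cmod (\<psi> x y) \<le> \<nu> * weight_ext g (fst x) * weight_ext g (fst y)" for x y
  proof (cases "x \<in> halfM \<and> y \<in> halfM")
    case True
    then have xy: "0 \<le> fst x" "0 \<le> fst y" by (auto simp: halfM_def)
    have *: "cmod (\<psi> x y) \<le> (\<nu> * g s') * weight_ext g (fst x)" if "fst y \<le> s'" "0 < s'" for s'
      using that xy \<nu>0 pos bound[OF xy] by (intro le_weight) (auto simp: mult_ac)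
    \<comment> \<open>The infimum over \<open>s'\<close> is taken with the factor \<nu> times the
      weight at \<open>x\<close>, which \<open>le_weight\<close> needs positive; a zero weight
      already forces \<psi> x y = 0 by the preceding estimate.\<close>
    show ?thesis
    proof (cases "weight_ext g (fst x) = 0")
      case False
      then have "weight_ext g (fst x) > 0" using nonneg[of "fst x"] by linarith
      then show ?thesis using xy \<nu>0 * by (intro le_weight) (auto simp: mult_ac)
    next
      case True
      then show ?thesis using *[of "fst y + 1"] xy by simp
    qed
  qed (use \<nu>0 in \<open>simp add: z\<close>)
  with \<nu>(1) \<nu>0 show ?thesis by (intro that)
qed

text \<open>The majorant \<open>B\<close> depends on the two times alone. The hypothesis on \<psi>
  uses the weight with the right limit, whereas the quotient bounded by \<open>C\<close> has
  \<open>g\<close> itself in the denominator, also at time 0.\<close>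

lemma opsup_le:
  assumes pos: "\<forall>t\<ge>0. g t > 0" and mono: "mono_on {0..} g"
    and bdd: "bdd_above ((\<lambda>t. 1 / g t) ` {0..})"
    and meas: "\<And>\<psi>. \<psi> \<in> schwartz_half \<Longrightarrow> (\<lambda>p. A \<psi> (fst p) (snd p)) \<in> borel_measurable borel"
    and bound: "\<And>\<psi> \<nu> x y. \<lbrakk>\<nu> > 0; \<And>x y. cmod (\<psi> x y) \<le> \<nu> * weight_ext g (fst x) * weight_ext g (fst y);
        fst x \<ge> 0; fst y \<ge> 0\<rbrakk> \<Longrightarrow> cmod (A \<psi> x y) \<le> \<nu> * B (fst x) (fst y)"
    and B: "\<And>s t. s \<ge> 0 \<Longrightarrow> t \<ge> 0 \<Longrightarrow> ereal (B s t / (g s * g t)) \<le> C"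
  shows "opsup g A \<le> C"
  unfolding opsup_def
proof (rule SUP_least)
  fix \<psi> assume "\<psi> \<in> schwartz_half - {\<lambda>_ _. 0}"
  then have \<psi>: "\<psi> \<in> schwartz_half" "\<psi> \<noteq> (\<lambda>_ _. 0)" by auto
  obtain \<nu> where \<nu>: "\<nu> > 0" "gnorm g \<psi> = ereal \<nu>"
    "\<And>x y. cmod (\<psi> x y) \<le> \<nu> * weight_ext g (fst x) * weight_ext g (fst y)"
    using schwartz_half_weight_bound[OF \<psi> pos mono bdd] by blast
  have "gnorm g (A \<psi>) \<le> ereal \<nu> * C"
  proof (rule gnorm_le[OF meas[OF \<psi>(1)] mono])
    fix x y :: mpoint assume xy: "fst x \<ge> 0" "fst y \<ge> 0"
    have "cmod (A \<psi> x y) / (g (fst x) * g (fst y)) \<le> \<nu> * B (fst x) (fst y) / (g (fst x) * g (fst y))"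
      using pos xy by (intro divide_right_mono bound[OF \<nu>(1,3) xy]) (auto simp: less_imp_le)
    then have "ereal (cmod (A \<psi> x y) / (g (fst x) * g (fst y))) \<le> ereal \<nu> * ereal (B (fst x) (fst y) / (g (fst x) * g (fst y)))"
      by simp
    also have "\<dots> \<le> ereal \<nu> * C"
      using \<nu>(1) by (intro ereal_mult_left_mono B xy) auto
    finally show "ereal (cmod (A \<psi> x y) / (g (fst x) * g (fst y))) \<le> ereal \<nu> * C" .
  qed
  then show "gnorm g (A \<psi>) / gnorm g \<psi> \<le> C"
    using \<nu>(1) by (simp add: \<nu>(2) ereal_divide_le_pos)
qed

section \<open>Measurability\<close>

lemma measurable_heaviside [measurable]: "heaviside \<in> borel_measurable borel"
  unfolding heaviside_def by measurable

lemma measurable_msq [measurable]: "msq \<in> borel_measurable borel"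
  unfolding msq_def by measurable

context
  fixes \<psi> :: "mpoint \<Rightarrow> mpoint \<Rightarrow> complex"
  assumes \<psi>: "(\<lambda>p. \<psi> (fst p) (snd p)) \<in> borel_measurable borel"
begin

lemma measurable_psi [measurable (raw)]:
  assumes "f \<in> borel_measurable M" "h \<in> borel_measurable M"
  shows "(\<lambda>x. \<psi> (f x) (h x)) \<in> borel_measurable M"
  using measurable_compose[OF borel_measurable_Pair[OF assms] \<psi>] by simp

lemma measurable_opA0: "(\<lambda>p. opA0 lam \<psi> (fst p) (snd p)) \<in> borel_measurable borel"
proof -
  \<comment> \<open>The radius varies with y, so membership in the ball is written as an inequality
    to obtain joint measurability.\<close>
  have ball: "ball 0 r = {z :: real^3. norm z < r}" for r by auto
  show ?thesis
    unfolding opA0_def sphere_integral_def set_lebesgue_integral_def Let_def ball by measurable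
qed

lemma measurable_opA1: "(\<lambda>p. opA1 lam m \<psi> (fst p) (snd p)) \<in> borel_measurable borel"
  unfolding opA1_def Let_def by measurable

lemma measurable_opA2: "(\<lambda>p. opA2 lam m \<psi> (fst p) (snd p)) \<in> borel_measurable borel"
  unfolding opA2_def Let_def by measurable

lemma measurable_opA12: "(\<lambda>p. opA12 lam m1 m2 \<psi> (fst p) (snd p)) \<in> borel_measurable borel"
  unfolding opA12_def sphere_integral_def set_lebesgue_integral_def Let_def by measurable

end

section \<open>Operator bounds\<close>

lemma ennreal_mult3:
  "0 \<le> a \<Longrightarrow> 0 \<le> b \<Longrightarrow> 0 \<le> c \<Longrightarrow> ennreal a * ennreal b * ennreal c = ennreal (a * b * c)"
  by (simp add: ennreal_mult)

lemma ennreal_lincomb: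
  "\<lbrakk>0 \<le> c; 0 \<le> p; 0 \<le> q; 0 \<le> a; 0 \<le> b\<rbrakk> \<Longrightarrow>
    ennreal (c * (p * a + q * b)) = ennreal c * (ennreal p * ennreal a + ennreal q * ennreal b)"
  by (simp add: ennreal_mult)

lemma ennreal_cmod_of_real_mult: "ennreal (cmod (complex_of_real c * z)) = ennreal \<bar>c\<bar> * ennreal (cmod z)"
  by (simp add: norm_mult ennreal_mult)

lemma norm_sphere_integral_le:
  "ennreal (cmod (sphere_integral f)) \<le>
    (\<integral>\<^sup>+th. (\<integral>\<^sup>+ph. ennreal (sin th) * ennreal (cmod (f (sphpt th ph))) * indicator {0..2 * pi} ph \<partial>lborel) * indicator {0..pi} th \<partial>lborel)"
  unfolding sphere_integral_def
proof (rule order_trans[OF norm_set_lebesgue_integral_le_nn_integral], rule nn_integral_mono)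
  fix th
  show "ennreal (cmod (set_lebesgue_integral lborel {0..2 * pi} (\<lambda>ph. complex_of_real (sin th) * f (sphpt th ph)))) * indicator {0..pi} th
     \<le> (\<integral>\<^sup>+ph. ennreal (sin th) * ennreal (cmod (f (sphpt th ph))) * indicator {0..2 * pi} ph \<partial>lborel) * indicator {0..pi} th"
  proof (cases "th \<in> {0..pi}")
    case True
    then have "sin th \<ge> 0" by (auto intro: sin_ge_zero)
    have "ennreal (cmod (set_lebesgue_integral lborel {0..2 * pi} (\<lambda>ph. complex_of_real (sin th) * f (sphpt th ph))))
      \<le> (\<integral>\<^sup>+ph. ennreal (sin th) * ennreal (cmod (f (sphpt th ph))) * indicator {0..2 * pi} ph \<partial>lborel)"
      by (rule order_trans[OF norm_set_lebesgue_integral_le_nn_integral], rule nn_integral_mono)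
         (simp add: norm_mult ennreal_mult \<open>sin th \<ge> 0\<close>)
    then show ?thesis by (rule mult_right_mono) simp
  qed simp
qed

text \<open>4 pi is the area of the sphere: the zonal formula with a constant profile, for which any
  unit vector serves as axis, gives 2 pi times the length 2 of [-1, 1].\<close>

lemma norm_sphere_integral_le_const:
  assumes "\<And>w. cmod (f w) \<le> c"
  shows "ennreal (cmod (sphere_integral f)) \<le> ennreal (4 * pi * c)"
proof -
  have c: "c \<ge> 0" using order_trans[OF norm_ge_zero assms] .
  have "ennreal (cmod (sphere_integral f)) \<le>
    (\<integral>\<^sup>+th. (\<integral>\<^sup>+ph. ennreal (sin th) * ennreal (cmod (f (sphpt th ph))) * indicator {0..2 * pi} ph \<partial>lborel) * indicator {0..pi} th \<partial>lborel)"
    by (rule norm_sphere_integral_le)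
  also have "\<dots> \<le> (\<integral>\<^sup>+th. (\<integral>\<^sup>+ph. ennreal (sin th) * ennreal c * indicator {0..2 * pi} ph \<partial>lborel) * indicator {0..pi} th \<partial>lborel)"
    by (intro nn_integral_mono mult_right_mono mult_left_mono ennreal_leI assms) auto
  also have "\<dots> = ennreal (2 * pi) * (\<integral>\<^sup>+u. ennreal c * indicator {-1..1::real} u \<partial>lborel)"
    by (rule nn_integral_sphere_zonal[where e="axis 1 1" and f="\<lambda>_. ennreal c"]) auto
  also have "\<dots> = ennreal (2 * pi) * (ennreal c * ennreal 2)"
    by (subst nn_integral_cmult_indicator) auto
  also have "\<dots> = ennreal (2 * pi) * ennreal c * ennreal 2"
    by (simp only: mult.assoc)
  also have "\<dots> = ennreal (4 * pi * c)"
    using c by (subst ennreal_mult3) (simp_all add: mult_ac)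
  finally show ?thesis .
qed

lemma nn_integral_cmult2:
  fixes f :: "'a::euclidean_space \<Rightarrow> 'b::euclidean_space \<Rightarrow> ennreal"
  assumes [measurable]: "case_prod f \<in> borel_measurable (lborel \<Otimes>\<^sub>M lborel)"
  shows "(\<integral>\<^sup>+x. \<integral>\<^sup>+y. c * f x y \<partial>lborel \<partial>lborel) = c * (\<integral>\<^sup>+x. \<integral>\<^sup>+y. f x y \<partial>lborel \<partial>lborel)"
proof -
  have "(\<integral>\<^sup>+y. c * f x y \<partial>lborel) = c * (\<integral>\<^sup>+y. f x y \<partial>lborel)" for x
    by (rule nn_integral_cmult) measurable
  then show ?thesis by (simp add: nn_integral_cmult)
qed

locale weighted_wave = weight +
  fixes \<psi> :: "mpoint \<Rightarrow> mpoint \<Rightarrow> complex" and \<nu> :: real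
  assumes \<nu>: "\<nu> \<ge> 0" and bound: "cmod (\<psi> x y) \<le> \<nu> * G (fst x) * G (fst y)"
begin

text \<open>For each y' the angular integral leaves 2 pi / (2 |b|) = pi / |b|. As b = a - y' with
  \<open>a\<close> the difference of the two positions, the y' integral has poles 0 and
  \<open>a\<close> and contributes 8 pi; altogether 8 pi^2 / (4 pi)^3 = 1 / (8 pi).\<close>

lemma norm_opA0_le:
  assumes lam: "lam \<ge> 0" and x: "fst x \<ge> 0"
  shows "ennreal (cmod (opA0 lam \<psi> x y)) \<le> ennreal (\<nu> * (lam / (8 * pi))) * rint 0 (fst x) * rint 0 (fst y)"
proof -
  define a where "a = snd x - snd y"
  let ?R = "rint 0 (fst x)"
  define k where "k = (\<lambda>yp \<omega>.
        let b0 = fst x - fst y + norm yp;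
            bv = snd x - snd y - yp;
            b2 = b0^2 - (norm bv)^2;
            c = (\<omega> \<bullet> bv) / norm bv;
            D = b0 + norm bv * c;
            r = b2 / (2 * D);
            thr = b2 / (2 * fst x * norm bv) - b0 / norm bv
        in complex_of_real (\<bar>b2\<bar> / (4 * D^2 * norm yp) *
             ((if b2 > 0 \<and> b0 > 0 \<and> c > thr then 1 else 0)
              + (if b2 < 0 \<and> c < thr then 1 else 0)))
           * \<psi> (fst x - r, snd x + r *\<^sub>R \<omega>) (fst y - norm yp, snd y + yp))"
  have sph: "ennreal (cmod (sphere_integral (k yp)))
      \<le> ennreal (\<nu> * pi) * ?R * ennreal (G (fst y - dist 0 yp) / (dist 0 yp * dist a yp))" if "yp \<noteq> a" for yp
  proof -
    define bv where "bv = snd x - snd y - yp"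
    define b0 where "b0 = fst x - fst y + norm yp"
    define b2 where "b2 = b0\<^sup>2 - (norm bv)\<^sup>2"
    define e where "e = bv /\<^sub>R norm bv"
    define q where "q = \<nu> * G (fst y - norm yp) / norm yp"
    have bv: "norm bv > 0" "norm bv = dist a yp"
      using that by (auto simp: bv_def a_def dist_norm)
    have e: "norm e = 1" using bv by (simp add: e_def)
    have q: "q \<ge> 0" using \<nu> by (simp add: q_def)
    have le: "cmod (k yp \<omega>) \<le> q * cone_kernel (fst x) (norm bv) b0 b2 (\<omega> \<bullet> e)" for \<omega>
    proof -
      have c: "(\<omega> \<bullet> bv) / norm bv = \<omega> \<bullet> e" by (simp add: e_def divide_inverse_commute)
      define D where "D = b0 + norm bv * (\<omega> \<bullet> e)"
      define I where "I = (if b2 > 0 \<and> b0 > 0 \<and> \<omega> \<bullet> e > b2 / (2 * fst x * norm bv) - b0 / norm bv then 1 else 0)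
              + (if b2 < 0 \<and> \<omega> \<bullet> e < b2 / (2 * fst x * norm bv) - b0 / norm bv then 1 else 0 :: real)"
      have I: "I \<ge> 0" by (simp add: I_def)
      define r where "r = b2 / (2 * D)"
      have "k yp \<omega> = complex_of_real (\<bar>b2\<bar> / (4 * D\<^sup>2 * norm yp) * I) * \<psi> (fst x - r, snd x + r *\<^sub>R \<omega>) (fst y - norm yp, snd y + yp)"
        unfolding k_def Let_def bv_def[symmetric] b0_def[symmetric] b2_def[symmetric] c D_def[symmetric] I_def[symmetric] r_def[symmetric] ..
      then have "cmod (k yp \<omega>) = \<bar>b2\<bar> / (4 * D\<^sup>2 * norm yp) * I * cmod (\<psi> (fst x - r, snd x + r *\<^sub>R \<omega>) (fst y - norm yp, snd y + yp))"
        using I by (simp only: norm_mult norm_of_real) simp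
      also have "\<dots> \<le> \<bar>b2\<bar> / (4 * D\<^sup>2 * norm yp) * I * (\<nu> * G (fst x - r) * G (fst y - norm yp))"
        using bound[of "(fst x - r, snd x + r *\<^sub>R \<omega>)" "(fst y - norm yp, snd y + yp)"] I
        by (intro mult_left_mono) auto
      also have "\<dots> = q * (\<bar>b2\<bar> / (4 * D\<^sup>2) * I * G (fst x - r))"
        by (simp add: q_def mult_ac)
      also have "\<bar>b2\<bar> / (4 * D\<^sup>2) * I * G (fst x - r) = cone_kernel (fst x) (norm bv) b0 b2 (\<omega> \<bullet> e)"
        by (simp add: cone_kernel_def D_def I_def r_def)
      finally show ?thesis .
    qed
    have "ennreal (cmod (sphere_integral (k yp))) \<le>
      (\<integral>\<^sup>+th. (\<integral>\<^sup>+ph. ennreal (sin th) * ennreal (cmod (k yp (sphpt th ph))) * indicator {0..2 * pi} ph \<partial>lborel) * indicator {0..pi} th \<partial>lborel)"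
      by (rule norm_sphere_integral_le)
    also have "\<dots> \<le> (\<integral>\<^sup>+th. (\<integral>\<^sup>+ph. ennreal (sin th) * ennreal (q * cone_kernel (fst x) (norm bv) b0 b2 (sphpt th ph \<bullet> e)) * indicator {0..2 * pi} ph \<partial>lborel) * indicator {0..pi} th \<partial>lborel)"
      by (intro nn_integral_mono mult_right_mono mult_left_mono ennreal_leI le) auto
    also have "\<dots> = ennreal (2 * pi) * (\<integral>\<^sup>+u. ennreal (q * cone_kernel (fst x) (norm bv) b0 b2 u) * indicator {-1..1} u \<partial>lborel)"
      by (rule nn_integral_sphere_zonal[OF _ e]) measurable
    also have "(\<integral>\<^sup>+u. ennreal (q * cone_kernel (fst x) (norm bv) b0 b2 u) * indicator {-1..1} u \<partial>lborel)
        = ennreal q * (\<integral>\<^sup>+u. ennreal (cone_kernel (fst x) (norm bv) b0 b2 u) * indicator {-1..1} u \<partial>lborel)"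
      by (subst nn_integral_cmult[symmetric]) (auto simp: ennreal_mult q mult.assoc)
    also have "ennreal (2 * pi) * \<dots> \<le> ennreal (2 * pi) * (ennreal q * (ennreal (1 / (2 * norm bv)) * ?R))"
      by (intro mult_left_mono nn_integral_cone_kernel bv x) auto
    also have "\<dots> = (ennreal (2 * pi) * ennreal q * ennreal (1 / (2 * norm bv))) * ?R"
      by (simp only: mult.assoc)
    also have "ennreal (2 * pi) * ennreal q * ennreal (1 / (2 * norm bv)) = ennreal (2 * pi * q * (1 / (2 * norm bv)))"
      using q by (intro ennreal_mult3) auto
    also have "2 * pi * q * (1 / (2 * norm bv)) = (\<nu> * pi) * (G (fst y - dist 0 yp) / (dist 0 yp * dist a yp))"
      by (simp add: q_def bv(2) divide_simps)
    also have "ennreal \<dots> * ?R = ennreal (\<nu> * pi) * ?R * ennreal (G (fst y - dist 0 yp) / (dist 0 yp * dist a yp))"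
      using \<nu> by (subst ennreal_mult) (auto simp: mult_ac)
    finally show ?thesis .
  qed
  have "ennreal (cmod (set_lebesgue_integral lborel (ball 0 (fst y)) (\<lambda>yp. sphere_integral (k yp))))
     \<le> (\<integral>\<^sup>+yp. ennreal (cmod (sphere_integral (k yp))) * indicator (ball 0 (fst y)) yp \<partial>lborel)"
    by (rule norm_set_lebesgue_integral_le_nn_integral)
  also have "\<dots> \<le> (\<integral>\<^sup>+yp. ennreal (\<nu> * pi) * ?R * ennreal (G (fst y - dist 0 yp) / (dist 0 yp * dist a yp)) \<partial>lborel)"
  proof (rule nn_integral_mono_AE)
    \<comment> \<open>At y' = a the vector b vanishes and provides no axis; this single point is a
      null set.\<close>
    show "AE yp in lborel. ennreal (cmod (sphere_integral (k yp))) * indicator (ball 0 (fst y)) yp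
       \<le> ennreal (\<nu> * pi) * ?R * ennreal (G (fst y - dist 0 yp) / (dist 0 yp * dist a yp))"
      using AE_lborel_singleton[of a]
    proof eventually_elim
      case (elim yp)
      then show ?case using sph[of yp] by (cases "yp \<in> ball 0 (fst y)") simp_all
    qed
  qed
  also have "\<dots> = ennreal (\<nu> * pi) * ?R * (\<integral>\<^sup>+yp. ennreal (G (fst y - dist 0 yp) / (dist 0 yp * dist a yp)) \<partial>lborel)"
    by (rule nn_integral_cmult) measurable
  also have "\<dots> \<le> ennreal (\<nu> * pi) * ?R * (ennreal (8 * pi) * rint 0 (fst y))"
    by (intro mult_left_mono nn_integral_two_poles) auto
  finally have main: "ennreal (cmod (set_lebesgue_integral lborel (ball 0 (fst y)) (\<lambda>yp. sphere_integral (k yp))))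
     \<le> ennreal (\<nu> * pi) * ?R * (ennreal (8 * pi) * rint 0 (fst y))" .
  have op: "opA0 lam \<psi> x y = complex_of_real (lam / (4 * pi) ^ 3) * set_lebesgue_integral lborel (ball 0 (fst y)) (\<lambda>yp. sphere_integral (k yp))"
    unfolding opA0_def k_def ..
  have "ennreal (cmod (opA0 lam \<psi> x y)) = ennreal (lam / (4 * pi) ^ 3) *
      ennreal (cmod (set_lebesgue_integral lborel (ball 0 (fst y)) (\<lambda>yp. sphere_integral (k yp))))"
    unfolding op ennreal_cmod_of_real_mult using lam by (simp add: abs_mult)
  also have "\<dots> \<le> ennreal (lam / (4 * pi) ^ 3) * (ennreal (\<nu> * pi) * ?R * (ennreal (8 * pi) * rint 0 (fst y)))"
    by (intro mult_left_mono main) simp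
  also have "\<dots> = (ennreal (lam / (4 * pi) ^ 3) * ennreal (\<nu> * pi) * ennreal (8 * pi)) * ?R * rint 0 (fst y)"
    by (simp only: mult_ac)
  also have "ennreal (lam / (4 * pi) ^ 3) * ennreal (\<nu> * pi) * ennreal (8 * pi) = ennreal (lam / (4 * pi) ^ 3 * (\<nu> * pi) * (8 * pi))"
    using lam \<nu> by (intro ennreal_mult3) auto
  also have "lam / (4 * pi) ^ 3 * (\<nu> * pi) * (8 * pi) = \<nu> * (lam / (8 * pi))"
    by (simp add: field_simps power3_eq_cube)
  finally show ?thesis .
qed

section \<open>The massive operators\<close>

lemma bessel_factor_le_cut:
  assumes "m \<ge> 0" "n \<ge> 0"
  shows "\<bar>heaviside a * heaviside (X - a - n) * besselJ1 (m * s) / s\<bar> * G a \<le> m / 2 * cut X a"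
proof (cases "a \<le> X")
  case True
  have "\<bar>heaviside a * heaviside (X - a - n) * besselJ1 (m * s) / s\<bar> \<le> m / 2"
    using abs_besselJ1_div_le[OF assms(1), of s] assms(1) by (simp add: heaviside_def)
  from mult_right_mono[OF this nonneg[of a]] True show ?thesis by (simp only: cut_def if_True)
\<comment> \<open>For a > X the argument X - a - n is negative, so the Heaviside factor is
  0.\<close>
qed (use assms in \<open>simp add: heaviside_def\<close>)

text \<open>Common to \<open>A1\<close> and \<open>A2\<close>: \<open>v\<close> is the time of the
  intermediate point on the massless particle's backward cone, \<open>p\<close> its spatial distance
  from the apex, \<open>d\<close> the distance between the primed points, and \<open>X\<close> the
  time bounding the massive propagator. The signs \<sigma> select the future and past cones.\<close>

lemma cone_integrand_le:
  assumes "m \<ge> 0" and w: "\<And>\<sigma>. cmod (w \<sigma>) \<le> \<nu> * G (v + \<sigma> * d) * G v" and d: "d \<ge> 0" "p \<ge> 0"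
    and n: "\<And>\<sigma>. n \<sigma> \<ge> 0"
  shows "ennreal (cmod (complex_of_real (heaviside v / (p * d)) *
      (\<Sum>\<sigma>\<in>{-1, 1::real}. complex_of_real (heaviside (v + \<sigma> * d) * heaviside (X - (v + \<sigma> * d) - n \<sigma>)
                  * besselJ1 (m * s \<sigma>) / s \<sigma>) * w \<sigma>)))
    \<le> ennreal (\<nu> * m / 2) * (ennreal (G v / p) * (ennreal (cut X (v + d) / d) + ennreal (cut X (v - d) / d)))"
proof -
  have summand: "cmod (complex_of_real (heaviside (v + \<sigma> * d) * heaviside (X - (v + \<sigma> * d) - n \<sigma>)
                  * besselJ1 (m * s \<sigma>) / s \<sigma>) * w \<sigma>) \<le> \<nu> * m / 2 * G v * cut X (v + \<sigma> * d)" for \<sigma>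
  proof -
    let ?b = "\<bar>heaviside (v + \<sigma> * d) * heaviside (X - (v + \<sigma> * d) - n \<sigma>) * besselJ1 (m * s \<sigma>) / s \<sigma>\<bar>"
    have "cmod (complex_of_real (heaviside (v + \<sigma> * d) * heaviside (X - (v + \<sigma> * d) - n \<sigma>)
                  * besselJ1 (m * s \<sigma>) / s \<sigma>) * w \<sigma>) = ?b * cmod (w \<sigma>)"
      by (simp only: norm_mult norm_of_real)
    also have "\<dots> \<le> ?b * (\<nu> * G (v + \<sigma> * d) * G v)" by (intro mult_left_mono w) simp
    also have "\<dots> = (\<nu> * G v) * (?b * G (v + \<sigma> * d))" by (simp only: mult_ac)
    also have "\<dots> \<le> (\<nu> * G v) * (m / 2 * cut X (v + \<sigma> * d))"
      using \<nu> by (intro mult_left_mono bessel_factor_le_cut assms(1) n) auto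
    finally show ?thesis by (simp add: mult_ac)
  qed
  have "cmod (\<Sum>\<sigma>\<in>{-1, 1::real}. complex_of_real (heaviside (v + \<sigma> * d) * heaviside (X - (v + \<sigma> * d) - n \<sigma>)
                  * besselJ1 (m * s \<sigma>) / s \<sigma>) * w \<sigma>)
      \<le> (\<Sum>\<sigma>\<in>{-1, 1::real}. \<nu> * m / 2 * G v * cut X (v + \<sigma> * d))"
    by (intro sum_norm_le summand)
  also have "\<dots> = \<nu> * m / 2 * G v * (cut X (v + d) + cut X (v - d))"
    by (simp add: algebra_simps)
  finally have S: "cmod (\<Sum>\<sigma>\<in>{-1, 1::real}. complex_of_real (heaviside (v + \<sigma> * d) * heaviside (X - (v + \<sigma> * d) - n \<sigma>)
                  * besselJ1 (m * s \<sigma>) / s \<sigma>) * w \<sigma>)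
      \<le> \<nu> * m / 2 * G v * (cut X (v + d) + cut X (v - d))" .
  have H: "cmod (complex_of_real (heaviside v / (p * d))) \<le> 1 / (p * d)"
    using d unfolding norm_of_real by (simp add: heaviside_def)
  have "cmod (complex_of_real (heaviside v / (p * d)) *
      (\<Sum>\<sigma>\<in>{-1, 1::real}. complex_of_real (heaviside (v + \<sigma> * d) * heaviside (X - (v + \<sigma> * d) - n \<sigma>)
                  * besselJ1 (m * s \<sigma>) / s \<sigma>) * w \<sigma>)) \<le> 1 / (p * d) * (\<nu> * m / 2 * G v * (cut X (v + d) + cut X (v - d)))"
    unfolding norm_mult[of "complex_of_real (heaviside v / (p * d))"]
    by (rule mult_mono[OF H S]) (use d in simp_all)
  also have "\<dots> = \<nu> * m / 2 * (G v / p * (cut X (v + d) / d + cut X (v - d) / d))"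
    by (simp add: add_divide_distrib[symmetric])
  finally have "ennreal (cmod (complex_of_real (heaviside v / (p * d)) *
      (\<Sum>\<sigma>\<in>{-1, 1::real}. complex_of_real (heaviside (v + \<sigma> * d) * heaviside (X - (v + \<sigma> * d) - n \<sigma>)
                  * besselJ1 (m * s \<sigma>) / s \<sigma>) * w \<sigma>))) \<le> ennreal (\<nu> * m / 2 * (G v / p * (cut X (v + d) / d + cut X (v - d) / d)))"
    by (rule ennreal_leI)
  also have "\<dots> = ennreal (\<nu> * m / 2) * (ennreal (G v / p) * (ennreal (cut X (v + d) / d) + ennreal (cut X (v - d) / d)))"
    using \<nu> assms(1) d by (simp only: ennreal_mult ennreal_plus divide_nonneg_nonneg mult_nonneg_nonneg add_nonneg_nonneg cut_nonneg nonneg zero_le_numeral)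
  finally show ?thesis .
qed

text \<open>1 / (2 (4 pi)^3) times 1/2 times 16 pi^2 is 1 / (16 pi). One factor \<open>m\<close> is
  the prefactor of the operator, the other comes from the Bessel bound.\<close>

lemma massive_cone_const:
  assumes "lam \<ge> 0" "m \<ge> 0" "X \<ge> 0" "Y \<ge> 0"
    and I: "I \<le> ennreal (\<nu> * m / 2) * (ennreal (16 * pi\<^sup>2 * (X + Y)) * rint 0 X * rint 1 Y)"
  shows "ennreal (lam * m / (2 * (4 * pi) ^ 3)) * I
    \<le> ennreal (\<nu> * (lam * m\<^sup>2 / (16 * pi)) * (X + Y)) * rint 0 X * rint 1 Y"
proof -
  have "ennreal (lam * m / (2 * (4 * pi) ^ 3)) * I
     \<le> ennreal (lam * m / (2 * (4 * pi) ^ 3)) * (ennreal (\<nu> * m / 2) * (ennreal (16 * pi\<^sup>2 * (X + Y)) * rint 0 X * rint 1 Y))"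
    by (intro mult_left_mono I) simp
  also have "\<dots> = (ennreal (lam * m / (2 * (4 * pi) ^ 3)) * ennreal (\<nu> * m / 2) * ennreal (16 * pi\<^sup>2 * (X + Y))) * rint 0 X * rint 1 Y"
    by (simp only: mult_ac)
  also have "ennreal (lam * m / (2 * (4 * pi) ^ 3)) * ennreal (\<nu> * m / 2) * ennreal (16 * pi\<^sup>2 * (X + Y))
    = ennreal (lam * m / (2 * (4 * pi) ^ 3) * (\<nu> * m / 2) * (16 * pi\<^sup>2 * (X + Y)))"
    using assms(1-4) \<nu> by (intro ennreal_mult3) auto
  also have "lam * m / (2 * (4 * pi) ^ 3) * (\<nu> * m / 2) * (16 * pi\<^sup>2 * (X + Y)) = \<nu> * (lam * m\<^sup>2 / (16 * pi)) * (X + Y)"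
    by (simp add: field_simps power3_eq_cube power2_eq_square)
  finally show ?thesis .
qed

lemma norm_opA1_le:
  assumes lam: "lam \<ge> 0" "m \<ge> 0" and xy: "fst x \<ge> 0" "fst y \<ge> 0"
  shows "ennreal (cmod (opA1 lam m \<psi> x y)) \<le>
    ennreal (\<nu> * (lam * m\<^sup>2 / (16 * pi)) * (fst x + fst y)) * rint 0 (fst x) * rint 1 (fst y)"
proof -
  define k where "k = (\<lambda>xp yp. let y0' = fst y - norm (snd y - yp)
      in complex_of_real (heaviside (fst y - norm (snd y - yp)) / (norm (snd y - yp) * norm (xp - yp))) *
         (\<Sum>\<sigma>\<in>{-1, 1::real}.
            let x0' = y0' + \<sigma> * norm (xp - yp);
                s = sqrt (msq (fst x - x0', snd x - xp))
            in complex_of_real (heaviside x0' * heaviside (fst x - x0' - norm (snd x - xp))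
                  * besselJ1 (m * s) / s) * \<psi> (x0', xp) (y0', yp)))"
  define B where "B = (\<lambda>z w. ennreal (G (fst y - dist (snd y) z) / dist (snd y) z) *
           (ennreal (cut (fst x) (fst y - dist (snd y) z + dist z w) / dist z w) + ennreal (cut (fst x) (fst y - dist (snd y) z - dist z w) / dist z w)))"
  have B [measurable]: "case_prod B \<in> borel_measurable (lborel \<Otimes>\<^sub>M lborel)"
    unfolding B_def by measurable
  have double: "(\<integral>\<^sup>+z. \<integral>\<^sup>+w. B z w \<partial>lborel \<partial>lborel)
      \<le> ennreal (16 * pi\<^sup>2 * (fst x + fst y)) * rint 0 (fst x) * rint 1 (fst y)"
    unfolding B_def by (rule nn_integral_double_cone) (fact xy)+
  have k: "ennreal (cmod (k xp yp)) \<le> ennreal (\<nu> * m / 2) * B yp xp" for xp yp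
    unfolding k_def B_def Let_def dist_norm norm_minus_commute[of yp xp]
  proof (rule cone_integrand_le[where n="\<lambda>_. norm (snd x - xp)" and d="norm (xp - yp)" and p="norm (snd y - yp)"
        and v="fst y - norm (snd y - yp)" and X="fst x" and m=m
        and w="\<lambda>\<sigma>. \<psi> (fst y - norm (snd y - yp) + \<sigma> * norm (xp - yp), xp) (fst y - norm (snd y - yp), yp)"])
    show "cmod (\<psi> (fst y - norm (snd y - yp) + \<sigma> * norm (xp - yp), xp) (fst y - norm (snd y - yp), yp))
       \<le> \<nu> * G (fst y - norm (snd y - yp) + \<sigma> * norm (xp - yp)) * G (fst y - norm (snd y - yp))" for \<sigma>
      by (rule order_trans[OF bound]) simp
  qed (simp_all add: lam)
  have "ennreal (cmod (\<integral>xp. \<integral>yp. k xp yp \<partial>lborel \<partial>lborel)) \<le> (\<integral>\<^sup>+xp. \<integral>\<^sup>+yp. ennreal (cmod (k xp yp)) \<partial>lborel \<partial>lborel)"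
    by (rule order_trans[OF norm_lebesgue_integral_le_nn_integral], rule nn_integral_mono,
        rule norm_lebesgue_integral_le_nn_integral)
  also have "\<dots> \<le> (\<integral>\<^sup>+xp. \<integral>\<^sup>+yp. ennreal (\<nu> * m / 2) * B yp xp \<partial>lborel \<partial>lborel)"
    by (intro nn_integral_mono k)
  \<comment> \<open>y' is the apex of the cone on which x' moves, so x' is integrated first,
    opposite to the order in \<open>opA1\<close>.\<close>
  also have "\<dots> = (\<integral>\<^sup>+yp. \<integral>\<^sup>+xp. ennreal (\<nu> * m / 2) * B yp xp \<partial>lborel \<partial>lborel)"
    by (rule lborel_pair.Fubini') measurable
  also have "\<dots> = ennreal (\<nu> * m / 2) * (\<integral>\<^sup>+yp. \<integral>\<^sup>+xp. B yp xp \<partial>lborel \<partial>lborel)"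
    by (rule nn_integral_cmult2[OF B])
  also have "\<dots> \<le> ennreal (\<nu> * m / 2) * (ennreal (16 * pi\<^sup>2 * (fst x + fst y)) * rint 0 (fst x) * rint 1 (fst y))"
    by (intro mult_left_mono double) simp
  finally have main: "ennreal (cmod (\<integral>xp. \<integral>yp. k xp yp \<partial>lborel \<partial>lborel))
     \<le> ennreal (\<nu> * m / 2) * (ennreal (16 * pi\<^sup>2 * (fst x + fst y)) * rint 0 (fst x) * rint 1 (fst y))" .
  have op: "opA1 lam m \<psi> x y = complex_of_real (- lam * m / (2 * (4 * pi) ^ 3)) * (\<integral>xp. \<integral>yp. k xp yp \<partial>lborel \<partial>lborel)"
    unfolding opA1_def k_def ..
  have "ennreal (cmod (opA1 lam m \<psi> x y)) = ennreal (lam * m / (2 * (4 * pi) ^ 3)) * ennreal (cmod (\<integral>xp. \<integral>yp. k xp yp \<partial>lborel \<partial>lborel))"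
    unfolding op ennreal_cmod_of_real_mult using lam by (simp add: abs_mult)
  also have "\<dots> \<le> ennreal (\<nu> * (lam * m\<^sup>2 / (16 * pi)) * (fst x + fst y)) * rint 0 (fst x) * rint 1 (fst y)"
    by (intro massive_cone_const lam xy main)
  finally show ?thesis .
qed

text \<open>Here the apex x' is already the outer variable, so the double cone estimate applies in
  the given order, with the two times exchanged.\<close>

lemma norm_opA2_le:
  assumes lam: "lam \<ge> 0" "m \<ge> 0" and xy: "fst x \<ge> 0" "fst y \<ge> 0"
  shows "ennreal (cmod (opA2 lam m \<psi> x y)) \<le>
    ennreal (\<nu> * (lam * m\<^sup>2 / (16 * pi)) * (fst y + fst x)) * rint 0 (fst y) * rint 1 (fst x)"
proof -
  define k where "k = (\<lambda>xp yp. let x0' = fst x - norm (snd x - xp)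
      in complex_of_real (heaviside (fst x - norm (snd x - xp)) / (norm (snd x - xp) * norm (xp - yp))) *
         (\<Sum>\<sigma>\<in>{-1, 1::real}.
            let y0' = x0' + \<sigma> * norm (xp - yp);
                s = sqrt (msq (fst y - y0', snd y - yp))
            in complex_of_real (heaviside y0' * heaviside (fst y - y0' - norm (snd y - yp))
                  * besselJ1 (m * s) / s) * \<psi> (x0', xp) (y0', yp)))"
  define B where "B = (\<lambda>z w. ennreal (G (fst x - dist (snd x) z) / dist (snd x) z) *
           (ennreal (cut (fst y) (fst x - dist (snd x) z + dist z w) / dist z w) + ennreal (cut (fst y) (fst x - dist (snd x) z - dist z w) / dist z w)))"
  have B [measurable]: "case_prod B \<in> borel_measurable (lborel \<Otimes>\<^sub>M lborel)"
    unfolding B_def by measurable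
  have double: "(\<integral>\<^sup>+z. \<integral>\<^sup>+w. B z w \<partial>lborel \<partial>lborel)
      \<le> ennreal (16 * pi\<^sup>2 * (fst y + fst x)) * rint 0 (fst y) * rint 1 (fst x)"
    unfolding B_def by (rule nn_integral_double_cone) (fact xy)+
  have k: "ennreal (cmod (k xp yp)) \<le> ennreal (\<nu> * m / 2) * B xp yp" for xp yp
    unfolding k_def B_def Let_def dist_norm
  proof (rule cone_integrand_le[where n="\<lambda>_. norm (snd y - yp)" and d="norm (xp - yp)" and p="norm (snd x - xp)"
        and v="fst x - norm (snd x - xp)" and X="fst y" and m=m
        and w="\<lambda>\<sigma>. \<psi> (fst x - norm (snd x - xp), xp) (fst x - norm (snd x - xp) + \<sigma> * norm (xp - yp), yp)"])
    show "cmod (\<psi> (fst x - norm (snd x - xp), xp) (fst x - norm (snd x - xp) + \<sigma> * norm (xp - yp), yp))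
       \<le> \<nu> * G (fst x - norm (snd x - xp) + \<sigma> * norm (xp - yp)) * G (fst x - norm (snd x - xp))" for \<sigma>
      by (rule order_trans[OF bound]) (simp add: mult_ac)
  qed (simp_all add: lam)
  have "ennreal (cmod (\<integral>xp. \<integral>yp. k xp yp \<partial>lborel \<partial>lborel)) \<le> (\<integral>\<^sup>+xp. \<integral>\<^sup>+yp. ennreal (cmod (k xp yp)) \<partial>lborel \<partial>lborel)"
    by (rule order_trans[OF norm_lebesgue_integral_le_nn_integral], rule nn_integral_mono,
        rule norm_lebesgue_integral_le_nn_integral)
  also have "\<dots> \<le> (\<integral>\<^sup>+xp. \<integral>\<^sup>+yp. ennreal (\<nu> * m / 2) * B xp yp \<partial>lborel \<partial>lborel)"
    by (intro nn_integral_mono k)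
  also have "\<dots> = ennreal (\<nu> * m / 2) * (\<integral>\<^sup>+xp. \<integral>\<^sup>+yp. B xp yp \<partial>lborel \<partial>lborel)"
    by (rule nn_integral_cmult2[OF B])
  also have "\<dots> \<le> ennreal (\<nu> * m / 2) * (ennreal (16 * pi\<^sup>2 * (fst y + fst x)) * rint 0 (fst y) * rint 1 (fst x))"
    by (intro mult_left_mono double) simp
  finally have main: "ennreal (cmod (\<integral>xp. \<integral>yp. k xp yp \<partial>lborel \<partial>lborel))
     \<le> ennreal (\<nu> * m / 2) * (ennreal (16 * pi\<^sup>2 * (fst y + fst x)) * rint 0 (fst y) * rint 1 (fst x))" .
  have op: "opA2 lam m \<psi> x y = complex_of_real (- lam * m / (2 * (4 * pi) ^ 3)) * (\<integral>xp. \<integral>yp. k xp yp \<partial>lborel \<partial>lborel)"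
    unfolding opA2_def k_def ..
  have "ennreal (cmod (opA2 lam m \<psi> x y)) = ennreal (lam * m / (2 * (4 * pi) ^ 3)) * ennreal (cmod (\<integral>xp. \<integral>yp. k xp yp \<partial>lborel \<partial>lborel))"
    unfolding op ennreal_cmod_of_real_mult using lam by (simp add: abs_mult)
  also have "\<dots> \<le> ennreal (\<nu> * (lam * m\<^sup>2 / (16 * pi)) * (fst y + fst x)) * rint 0 (fst y) * rint 1 (fst x)"
    by (intro massive_cone_const lam xy main)
  finally show ?thesis .
qed

text \<open>From the inside out, the sphere gives 4 pi, y'^0 gives g1(Y), and x' the volume of a
  ball of radius X - u with u = x'^0. The remaining polynomial (u + Y) (X - u)^3 is lowered to the
  powers 1 and 2 of X - u that occur in \<open>rint 1\<close> and \<open>rint 2\<close>.\<close>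

lemma norm_opA12_le:
  assumes lam: "lam \<ge> 0" "m1 \<ge> 0" "m2 \<ge> 0" and xy: "fst x \<ge> 0" "fst y \<ge> 0"
  shows "ennreal (cmod (opA12 lam m1 m2 \<psi> x y)) \<le> ennreal (\<nu> * (lam * m1\<^sup>2 * m2\<^sup>2 / (96 * pi))) *
    (ennreal ((fst x)\<^sup>2 * fst y) * rint 1 (fst x) + ennreal ((fst x)\<^sup>2 / 4) * rint 2 (fst x)) * rint 0 (fst y)"
proof -
  let ?X = "fst x" and ?Y = "fst y"
  define k where "k = (\<lambda>x0' xp y0' \<omega>.
        let yp = xp - \<bar>x0' - y0'\<bar> *\<^sub>R \<omega>;
            s1 = sqrt (msq (fst x - x0', snd x - xp));
            s2 = sqrt (msq (fst y - y0', snd y - yp))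
        in complex_of_real (\<bar>x0' - y0'\<bar>
              * heaviside (fst x - x0' - norm (snd x - xp)) * besselJ1 (m1 * s1) / s1
              * heaviside (fst y - y0' - norm (snd y - yp)) * besselJ1 (m2 * s2) / s2)
           * \<psi> (x0', xp) (y0', yp))"
  \<comment> \<open>Here pi is the area 4 pi of the sphere times the two factors 1/2 of the Bessel
    bounds.\<close>
  define c where "c = (\<lambda>u. pi * \<nu> * m1 * m2 * (u + ?Y) * G u)"
  have c: "c u \<ge> 0" if "u \<ge> 0" for u
    using that \<nu> lam xy by (simp add: c_def)
  have k: "cmod (k u xp v \<omega>) \<le> 1 / (4 * pi) * (c u * indicator (cball (snd x) (?X - u)) xp * cut ?Y v)"
    if uv: "u \<ge> 0" "v \<ge> 0" for u xp v \<omega>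
  proof -
    define yp where "yp = xp - \<bar>u - v\<bar> *\<^sub>R \<omega>"
    define s1 where "s1 = sqrt (msq (fst x - u, snd x - xp))"
    define s2 where "s2 = sqrt (msq (fst y - v, snd y - yp))"
    define h1 where "h1 = heaviside (fst x - u - norm (snd x - xp))"
    define h2 where "h2 = heaviside (fst y - v - norm (snd y - yp))"
    have h: "h1 \<ge> 0" "h2 \<ge> 0" "h1 = indicator (cball (snd x) (?X - u)) xp"
      by (auto simp: h1_def h2_def heaviside_def dist_norm indicator_def)
    \<comment> \<open>For v \<le> Y the distance |u - v| is at most u + Y, which no longer depends
      on v; for v > Y the Heaviside factor vanishes.\<close>
    have G2: "\<bar>u - v\<bar> * (h2 * G v) \<le> (u + ?Y) * cut ?Y v"
    proof (cases "v \<le> ?Y")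
      case True
      then show ?thesis using uv h(2)
        by (intro mult_mono) (auto simp: h2_def heaviside_def cut_def)
    next
      case False
      then have "h2 = 0" using norm_ge_zero[of "snd y - yp"] by (auto simp: h2_def heaviside_def simp del: norm_ge_zero)
      then show ?thesis using uv xy by simp
    qed
    have "k u xp v \<omega> = complex_of_real (\<bar>u - v\<bar> * h1 * besselJ1 (m1 * s1) / s1 * h2 * besselJ1 (m2 * s2) / s2) * \<psi> (u, xp) (v, yp)"
      unfolding k_def Let_def yp_def[symmetric] s1_def[symmetric] s2_def[symmetric] h1_def[symmetric] h2_def[symmetric] ..
    then have "cmod (k u xp v \<omega>) = \<bar>\<bar>u - v\<bar> * h1 * besselJ1 (m1 * s1) / s1 * h2 * besselJ1 (m2 * s2) / s2\<bar> * cmod (\<psi> (u, xp) (v, yp))"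
      by (simp only: norm_mult norm_of_real)
    also have "\<bar>\<bar>u - v\<bar> * h1 * besselJ1 (m1 * s1) / s1 * h2 * besselJ1 (m2 * s2) / s2\<bar>
        = \<bar>u - v\<bar> * h1 * h2 * (\<bar>besselJ1 (m1 * s1) / s1\<bar> * \<bar>besselJ1 (m2 * s2) / s2\<bar>)"
      using h by (simp add: abs_mult)
    also have "\<dots> * cmod (\<psi> (u, xp) (v, yp)) \<le> \<bar>u - v\<bar> * h1 * h2 * (m1 / 2 * (m2 / 2)) * (\<nu> * G u * G v)"
      using bound[of "(u, xp)" "(v, yp)"] lam h
      by (intro mult_mono mult_left_mono abs_besselJ1_div_le) auto
    also have "\<dots> = (m1 * m2 / 4 * \<nu> * G u * h1) * (\<bar>u - v\<bar> * (h2 * G v))"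
      by (simp add: mult_ac)
    also have "\<dots> \<le> (m1 * m2 / 4 * \<nu> * G u * h1) * ((u + ?Y) * cut ?Y v)"
      using lam \<nu> h by (intro mult_left_mono G2) auto
    also have "\<dots> = 1 / (4 * pi) * (c u * h1 * cut ?Y v)"
      by (simp add: c_def)
    finally show ?thesis by (simp only: h(3))
  qed
  have sph: "ennreal (cmod (sphere_integral (k u xp v))) \<le> ennreal (c u * indicator (cball (snd x) (?X - u)) xp) * ennreal (cut ?Y v)"
    if uv: "u \<ge> 0" "v \<ge> 0" for u xp v
  proof -
    have "ennreal (cmod (sphere_integral (k u xp v))) \<le> ennreal (4 * pi * (1 / (4 * pi) * (c u * indicator (cball (snd x) (?X - u)) xp * cut ?Y v)))"
      by (intro norm_sphere_integral_le_const k uv)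
    also have "4 * pi * (1 / (4 * pi) * (c u * indicator (cball (snd x) (?X - u)) xp * cut ?Y v))
        = (c u * indicator (cball (snd x) (?X - u)) xp) * cut ?Y v" by simp
    also have "ennreal \<dots> = ennreal (c u * indicator (cball (snd x) (?X - u)) xp) * ennreal (cut ?Y v)"
      using c uv by (intro ennreal_mult) auto
    finally show ?thesis .
  qed
  have I3: "ennreal (cmod (set_lebesgue_integral lborel {0..} (\<lambda>v. sphere_integral (k u xp v))))
      \<le> ennreal (c u) * rint 0 ?Y * indicator (cball (snd x) (?X - u)) xp" if u: "u \<ge> 0" for u xp
  proof -
    have "ennreal (cmod (set_lebesgue_integral lborel {0..} (\<lambda>v. sphere_integral (k u xp v))))
       \<le> (\<integral>\<^sup>+v. ennreal (cmod (sphere_integral (k u xp v))) * indicator {0..} v \<partial>lborel)"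
      by (rule norm_set_lebesgue_integral_le_nn_integral)
    also have "\<dots> \<le> (\<integral>\<^sup>+v. ennreal (c u * indicator (cball (snd x) (?X - u)) xp) * ennreal (cut ?Y v) \<partial>lborel)"
    proof (rule nn_integral_mono)
      fix v :: real
      show "ennreal (cmod (sphere_integral (k u xp v))) * indicator {0..} v
        \<le> ennreal (c u * indicator (cball (snd x) (?X - u)) xp) * ennreal (cut ?Y v)"
        using sph[OF u, of v xp] by (cases "v \<ge> 0") simp_all
    qed
    also have "\<dots> = ennreal (c u * indicator (cball (snd x) (?X - u)) xp) * rint 0 ?Y"
      by (subst nn_integral_cmult) (simp_all add: nn_integral_cut)
    also have "\<dots> = ennreal (c u) * rint 0 ?Y * indicator (cball (snd x) (?X - u)) xp"
      by (auto split: split_indicator)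
    finally show ?thesis .
  qed
  \<comment> \<open>The volume 4/3 pi of the unit ball times the factor pi in
    \<open>c\<close>.\<close>
  define C where "C = 4 / 3 * pi\<^sup>2 * \<nu> * m1 * m2"
  have C: "C \<ge> 0" using \<nu> lam by (simp add: C_def)
  have I2: "ennreal (cmod (\<integral>xp. set_lebesgue_integral lborel {0..} (\<lambda>v. sphere_integral (k u xp v)) \<partial>lborel)) * indicator {0..} u
      \<le> ennreal C * rint 0 ?Y * (ennreal (?X\<^sup>2 * ?Y) * (ennreal ((?X - u) ^ 1 * G u) * indicator {0..?X} u)
          + ennreal (?X\<^sup>2 / 4) * (ennreal ((?X - u) ^ 2 * G u) * indicator {0..?X} u))" for u
  proof (cases "u \<ge> 0")
    case u: True
    have "ennreal (cmod (\<integral>xp. set_lebesgue_integral lborel {0..} (\<lambda>v. sphere_integral (k u xp v)) \<partial>lborel))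
       \<le> (\<integral>\<^sup>+xp. ennreal (cmod (set_lebesgue_integral lborel {0..} (\<lambda>v. sphere_integral (k u xp v)))) \<partial>lborel)"
      by (rule norm_lebesgue_integral_le_nn_integral)
    also have "\<dots> \<le> (\<integral>\<^sup>+xp. ennreal (c u) * rint 0 ?Y * indicator (cball (snd x) (?X - u)) xp \<partial>lborel)"
      by (intro nn_integral_mono I3 u)
    also have "\<dots> = ennreal (c u) * rint 0 ?Y * emeasure lborel (cball (snd x) (?X - u))"
      by (rule nn_integral_cmult_indicator) simp
    finally have le: "ennreal (cmod (\<integral>xp. set_lebesgue_integral lborel {0..} (\<lambda>v. sphere_integral (k u xp v)) \<partial>lborel))
       \<le> ennreal (c u) * rint 0 ?Y * emeasure lborel (cball (snd x) (?X - u))" .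
    show ?thesis
    proof (cases "u \<le> ?X")
      case True
      define d where "d = ?X - u"
      have d: "0 \<le> d" "d \<le> ?X" using True u by (auto simp: d_def)
      have "d\<^sup>2 \<le> ?X\<^sup>2" using d by (intro power_mono)
      then have "?Y * d * d\<^sup>2 \<le> ?Y * d * ?X\<^sup>2" using xy d by (intro mult_left_mono) auto
      \<comment> \<open>The arithmetic-geometric mean inequality for u + d = X. One factor of d^3 is
        spent on it and d^2 is left.\<close>
      moreover have "u * d \<le> ?X\<^sup>2 / 4"
        using zero_le_power2[of "u - d"] by (simp add: d_def power2_eq_square algebra_simps)
      then have "u * d * d\<^sup>2 \<le> ?X\<^sup>2 / 4 * d\<^sup>2" by (intro mult_right_mono) auto
      ultimately have "(u + ?Y) * d ^ 3 \<le> ?X\<^sup>2 * ?Y * d + ?X\<^sup>2 / 4 * d\<^sup>2"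
        by (simp add: power2_eq_square power3_eq_cube algebra_simps)
      then have "C * G u * ((u + ?Y) * d ^ 3) \<le> C * G u * (?X\<^sup>2 * ?Y * d + ?X\<^sup>2 / 4 * d\<^sup>2)"
        using C by (intro mult_left_mono) auto
      then have le2: "c u * (4 / 3 * pi * d ^ 3) \<le> C * (?X\<^sup>2 * ?Y * (d ^ 1 * G u) + ?X\<^sup>2 / 4 * (d\<^sup>2 * G u))"
        by (simp add: c_def C_def power2_eq_square algebra_simps)
      have "ennreal (c u) * rint 0 ?Y * emeasure lborel (cball (snd x) (?X - u)) = ennreal (c u * (4 / 3 * pi * d ^ 3)) * rint 0 ?Y"
      proof -
        have "emeasure lborel (cball (snd x) (?X - u)) = ennreal (4 / 3 * pi * d ^ 3)"
          using d by (simp add: emeasure_cball unit_ball_vol_3 flip: d_def)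
        moreover have "ennreal (c u * (4 / 3 * pi * d ^ 3)) = ennreal (c u) * ennreal (4 / 3 * pi * d ^ 3)"
          using d c[OF u] by (intro ennreal_mult) auto
        ultimately show ?thesis by (simp only: mult_ac)
      qed
      also have "\<dots> \<le> ennreal (C * (?X\<^sup>2 * ?Y * (d ^ 1 * G u) + ?X\<^sup>2 / 4 * (d\<^sup>2 * G u))) * rint 0 ?Y"
        by (intro mult_right_mono ennreal_leI le2) simp
      also have "ennreal (C * (?X\<^sup>2 * ?Y * (d ^ 1 * G u) + ?X\<^sup>2 / 4 * (d\<^sup>2 * G u)))
          = ennreal C * (ennreal (?X\<^sup>2 * ?Y) * ennreal (d ^ 1 * G u) + ennreal (?X\<^sup>2 / 4) * ennreal (d\<^sup>2 * G u))"
        using C xy d by (intro ennreal_lincomb) auto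
      finally show ?thesis using le True u by (simp add: d_def mult_ac)
    next
      case False
      then have "cball (snd x) (?X - u) = {}" by simp
      then show ?thesis using le by simp
    qed
  qed simp
  have "ennreal (cmod (set_lebesgue_integral lborel {0..} (\<lambda>u. \<integral>xp. set_lebesgue_integral lborel {0..} (\<lambda>v. sphere_integral (k u xp v)) \<partial>lborel)))
     \<le> (\<integral>\<^sup>+u. ennreal (cmod (\<integral>xp. set_lebesgue_integral lborel {0..} (\<lambda>v. sphere_integral (k u xp v)) \<partial>lborel)) * indicator {0..} u \<partial>lborel)"
    by (rule norm_set_lebesgue_integral_le_nn_integral)
  also have "\<dots> \<le> (\<integral>\<^sup>+u. ennreal C * rint 0 ?Y * (ennreal (?X\<^sup>2 * ?Y) * (ennreal ((?X - u) ^ 1 * G u) * indicator {0..?X} u)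
          + ennreal (?X\<^sup>2 / 4) * (ennreal ((?X - u) ^ 2 * G u) * indicator {0..?X} u)) \<partial>lborel)"
    by (intro nn_integral_mono I2)
  also have "\<dots> = ennreal C * rint 0 ?Y * (ennreal (?X\<^sup>2 * ?Y) * rint 1 ?X + ennreal (?X\<^sup>2 / 4) * rint 2 ?X)"
    unfolding rint_def[of 1] rint_def[of 2]
    by (subst nn_integral_cmult, measurable) (subst nn_integral_add, measurable, (subst nn_integral_cmult, measurable)+)
  finally have main: "ennreal (cmod (set_lebesgue_integral lborel {0..} (\<lambda>u. \<integral>xp. set_lebesgue_integral lborel {0..} (\<lambda>v. sphere_integral (k u xp v)) \<partial>lborel)))
     \<le> ennreal C * rint 0 ?Y * (ennreal (?X\<^sup>2 * ?Y) * rint 1 ?X + ennreal (?X\<^sup>2 / 4) * rint 2 ?X)" (is "?I \<le> ?J") .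
  have op: "opA12 lam m1 m2 \<psi> x y = complex_of_real (lam * m1 * m2 / (2 * (4 * pi) ^ 3)) *
      set_lebesgue_integral lborel {0..} (\<lambda>u. \<integral>xp. set_lebesgue_integral lborel {0..} (\<lambda>v. sphere_integral (k u xp v)) \<partial>lborel)"
    unfolding opA12_def k_def ..
  have "ennreal (cmod (opA12 lam m1 m2 \<psi> x y)) = ennreal (lam * m1 * m2 / (2 * (4 * pi) ^ 3)) * ?I"
    unfolding op ennreal_cmod_of_real_mult using lam by (simp add: abs_mult)
  also have "\<dots> \<le> ennreal (lam * m1 * m2 / (2 * (4 * pi) ^ 3)) * ?J"
    by (intro mult_left_mono main) simp
  also have "\<dots> = (ennreal (lam * m1 * m2 / (2 * (4 * pi) ^ 3)) * ennreal C) * (ennreal (?X\<^sup>2 * ?Y) * rint 1 ?X + ennreal (?X\<^sup>2 / 4) * rint 2 ?X) * rint 0 ?Y"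
    by (simp only: mult_ac)
  also have "ennreal (lam * m1 * m2 / (2 * (4 * pi) ^ 3)) * ennreal C = ennreal (lam * m1 * m2 / (2 * (4 * pi) ^ 3) * C)"
    using lam C by (intro ennreal_mult[symmetric]) auto
  also have "lam * m1 * m2 / (2 * (4 * pi) ^ 3) * C = \<nu> * (lam * m1\<^sup>2 * m2\<^sup>2 / (96 * pi))"
    by (simp add: C_def field_simps power3_eq_cube power2_eq_square)
  finally show ?thesis .
qed

end

section \<open>Products of suprema and the four estimates\<close>

lemma tsup_mult_ge:
  assumes "s \<ge> 0" "t \<ge> 0" "f s \<ge> 0" "h t \<ge> 0"
  shows "ereal (f s * h t) \<le> tsup f * tsup h" "tsup f * tsup h \<ge> 0"
proof -
  have f: "ereal (f s) \<le> tsup f" and h: "ereal (h t) \<le> tsup h"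
    unfolding tsup_def by (rule SUP_upper; use assms in simp)+
  have "ereal (f s * h t) = ereal (f s) * ereal (h t)" by simp
  \<comment> \<open>Nonnegativity of both factors makes multiplication monotone in
    \<open>ereal\<close>, also when a supremum is infinite.\<close>
  also have "\<dots> \<le> tsup f * tsup h"
    using assms order_trans[OF _ f, of 0] by (intro ereal_mult_mono f h) auto
  finally show 1: "ereal (f s * h t) \<le> tsup f * tsup h" .
  have "0 \<le> ereal (f s * h t)" using assms by simp
  then show "tsup f * tsup h \<ge> 0" using 1 by (rule order_trans)
qed

text \<open>Raises the coefficients of the kernel estimates to the numerals of the claim.\<close>

lemma ereal_le_numeral_mult:
  assumes "a * b \<ge> (0 :: ereal)" shows "a * b \<le> numeral n * a * b"
proof -
  have "1 * (a * b) \<le> numeral n * (a * b)"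
    using assms by (intro ereal_mult_right_mono) auto
  then show ?thesis by (simp add: mult.assoc)
qed

theorem theorem1:
  fixes g :: "real \<Rightarrow> real" and lam m1 m2 :: real
  assumes "lam > 0" and "m1 \<ge> 0" and "m2 \<ge> 0"
    and "\<forall>t\<ge>0. g t > 0"
    and "mono_on {0..} g"
    and "bdd_above ((\<lambda>t. 1 / g t) ` {0..})"
  shows "(opsup g (opA0 lam)
           \<le> ereal (lam / (8*pi)) * (tsup (\<lambda>t. giter g 1 t / g t))^2)
    \<and> (opsup g (opA1 lam m1)
           \<le> ereal (lam * m1^2 / (16*pi)) *
              (3 * tsup (\<lambda>t. t * giter g 1 t / g t) * tsup (\<lambda>t. giter g 2 t / g t)
             + 3 * tsup (\<lambda>t. giter g 1 t / g t) * tsup (\<lambda>t. t * giter g 2 t / g t)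
             + 2 * tsup (\<lambda>t. giter g 1 t / g t) * tsup (\<lambda>t. giter g 3 t / g t)))
    \<and> (opsup g (opA2 lam m2)
           \<le> ereal (lam * m2^2 / (16*pi)) *
              (3 * tsup (\<lambda>t. t * giter g 1 t / g t) * tsup (\<lambda>t. giter g 2 t / g t)
             + 3 * tsup (\<lambda>t. giter g 1 t / g t) * tsup (\<lambda>t. t * giter g 2 t / g t)
             + 2 * tsup (\<lambda>t. giter g 1 t / g t) * tsup (\<lambda>t. giter g 3 t / g t)))
    \<and> (opsup g (opA12 lam m1 m2)
           \<le> ereal (lam * m1^2 * m2^2 / (96*pi)) *
              (tsup (\<lambda>t. t^2 * giter g 2 t / g t) * tsup (\<lambda>t. t * giter g 1 t / g t)
             + ereal (1/2) * tsup (\<lambda>t. t^2 * giter g 3 t / g t) * tsup (\<lambda>t. giter g 1 t / g t)))"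
proof -
  note lam = assms(1) and m = assms(2,3) and pos = assms(4) and mono = assms(5) and bdd = assms(6)
  note opsup_le' = opsup_le[OF pos mono bdd]
  interpret W: weight "weight_ext g" by (rule weight_weight_ext[OF pos mono])
  have gW: "g t = weight_ext g t" if "t > 0" for t using that by (simp add: weight_ext_def)
  define g1 where "g1 = giter g 1"
  define g2 where "g2 = giter g 2"
  define g3 where "g3 = giter g 3"
  \<comment> \<open>n! times the (n+1)-fold integral for n = 0, 1, 2; the 2 in \<open>r3\<close> is
    2!.\<close>
  have r1: "W.rint 0 t = ennreal (g1 t)" "g1 t \<ge> 0" and r2: "W.rint 1 t = ennreal (g2 t)" "g2 t \<ge> 0"
    and r3: "W.rint 2 t = ennreal (2 * g3 t)" "g3 t \<ge> 0" if "t \<ge> 0" for t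
    using W.giter_eq_rint[OF gW that, of 0] W.giter_eq_rint[OF gW that, of 1] W.giter_eq_rint[OF gW that, of 2]
    by (simp_all only: g1_def g2_def g3_def One_nat_def Suc_1 numeral_3_eq_3 numeral_2_eq_2 fact_0 fact_Suc) simp_all
  have gp: "g t > 0" if "t \<ge> 0" for t using pos that by simp
  have wave: "weighted_wave (weight_ext g) \<psi> \<nu>"
    if "\<nu> > 0" "\<And>x y. cmod (\<psi> x y) \<le> \<nu> * weight_ext g (fst x) * weight_ext g (fst y)" for \<psi> \<nu>
    by unfold_locales (use that in auto)
  have A0: "opsup g (opA0 lam) \<le> ereal (lam / (8 * pi)) * (tsup (\<lambda>t. g1 t / g t))\<^sup>2"
  proof (rule opsup_le'[where B="\<lambda>s t. lam / (8 * pi) * g1 s * g1 t"])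
    show "(\<lambda>p. opA0 lam \<psi> (fst p) (snd p)) \<in> borel_measurable borel" if "\<psi> \<in> schwartz_half" for \<psi>
      by (rule measurable_opA0[OF schwartz_half_measurable[OF that]])
    fix \<psi> :: "mpoint \<Rightarrow> mpoint \<Rightarrow> complex" and \<nu> and x y :: mpoint
    assume \<nu>: "\<nu> > 0" and b: "\<And>x y. cmod (\<psi> x y) \<le> \<nu> * weight_ext g (fst x) * weight_ext g (fst y)"
      and xy: "fst x \<ge> 0" "fst y \<ge> 0"
    interpret weighted_wave "weight_ext g" \<psi> \<nu> using \<nu> b by (rule wave)
    have "ennreal (cmod (opA0 lam \<psi> x y)) \<le> ennreal (\<nu> * (lam / (8 * pi))) * ennreal (g1 (fst x)) * ennreal (g1 (fst y))"
      using norm_opA0_le[of lam x y] lam xy by (simp add: r1)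
    also have "\<dots> = ennreal (\<nu> * (lam / (8 * pi)) * g1 (fst x) * g1 (fst y))"
      using \<nu> lam xy r1 by (intro ennreal_mult3) auto
    finally show "cmod (opA0 lam \<psi> x y) \<le> \<nu> * (lam / (8 * pi) * g1 (fst x) * g1 (fst y))"
      using \<nu> lam xy r1 by (subst (asm) ennreal_le_iff) (auto simp: mult.assoc)
  next
    fix s t :: real assume st: "s \<ge> 0" "t \<ge> 0"
    have "ereal (lam / (8 * pi) * g1 s * g1 t / (g s * g t)) = ereal (lam / (8 * pi)) * ereal (g1 s / g s * (g1 t / g t))"
      by simp
    also have "\<dots> \<le> ereal (lam / (8 * pi)) * (tsup (\<lambda>t. g1 t / g t) * tsup (\<lambda>t. g1 t / g t))"
      using lam st gp r1 by (intro ereal_mult_left_mono tsup_mult_ge) (auto simp: less_imp_le)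
    finally show "ereal (lam / (8 * pi) * g1 s * g1 t / (g s * g t)) \<le> ereal (lam / (8 * pi)) * (tsup (\<lambda>t. g1 t / g t))\<^sup>2"
      by (simp add: power2_eq_square)
  qed
  define R where "R = 3 * tsup (\<lambda>t. t * g1 t / g t) * tsup (\<lambda>t. g2 t / g t)
     + 3 * tsup (\<lambda>t. g1 t / g t) * tsup (\<lambda>t. t * g2 t / g t)
     + 2 * tsup (\<lambda>t. g1 t / g t) * tsup (\<lambda>t. g3 t / g t)"
  have R: "ereal (lam * m\<^sup>2 / (16 * pi) * (s + t) * g1 s * g2 t / (g s * g t)) \<le> ereal (lam * m\<^sup>2 / (16 * pi)) * R"
    if st: "s \<ge> 0" "t \<ge> 0" for m s t
  proof -
    let ?c = "lam * m\<^sup>2 / (16 * pi)"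
    note nn = gp[OF st(1)] gp[OF st(2)] r1(2)[OF st(1)] r2(2)[OF st(2)] r3(2)[OF st(2)] st
    have 1: "ereal (s * g1 s / g s * (g2 t / g t)) \<le> tsup (\<lambda>t. t * g1 t / g t) * tsup (\<lambda>t. g2 t / g t)"
        "tsup (\<lambda>t. t * g1 t / g t) * tsup (\<lambda>t. g2 t / g t) \<ge> 0"
      using nn tsup_mult_ge[of s t "\<lambda>t. t * g1 t / g t" "\<lambda>t. g2 t / g t"] by auto
    have 2: "ereal (g1 s / g s * (t * g2 t / g t)) \<le> tsup (\<lambda>t. g1 t / g t) * tsup (\<lambda>t. t * g2 t / g t)"
        "tsup (\<lambda>t. g1 t / g t) * tsup (\<lambda>t. t * g2 t / g t) \<ge> 0"
      using nn tsup_mult_ge[of s t "\<lambda>t. g1 t / g t" "\<lambda>t. t * g2 t / g t"] by auto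
    have 3: "tsup (\<lambda>t. g1 t / g t) * tsup (\<lambda>t. g3 t / g t) \<ge> 0"
      using nn tsup_mult_ge[of s t "\<lambda>t. g1 t / g t" "\<lambda>t. g3 t / g t"] by auto
    \<comment> \<open>The factor s + t splits the majorant into the first two products; the summand
      0 is compared with the third, nonnegative by \<open>3\<close>.\<close>
    have "ereal (?c * (s + t) * g1 s * g2 t / (g s * g t))
        = ereal ?c * (ereal (s * g1 s / g s * (g2 t / g t)) + ereal (g1 s / g s * (t * g2 t / g t)) + 0)"
      using nn by (simp add: field_simps)
    also have "\<dots> \<le> ereal ?c * R"
      unfolding R_def
      using lam order_trans[OF 1(1) ereal_le_numeral_mult[OF 1(2)]] order_trans[OF 2(1) ereal_le_numeral_mult[OF 2(2)]]
        order_trans[OF 3 ereal_le_numeral_mult[OF 3]]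
      by (intro ereal_mult_left_mono add_mono) auto
    finally show ?thesis .
  qed
  have A1: "opsup g (opA1 lam m1) \<le> ereal (lam * m1\<^sup>2 / (16 * pi)) * R"
  proof (rule opsup_le'[where B="\<lambda>s t. lam * m1\<^sup>2 / (16 * pi) * (s + t) * g1 s * g2 t"])
    show "(\<lambda>p. opA1 lam m1 \<psi> (fst p) (snd p)) \<in> borel_measurable borel" if "\<psi> \<in> schwartz_half" for \<psi>
      by (rule measurable_opA1[OF schwartz_half_measurable[OF that]])
    fix \<psi> :: "mpoint \<Rightarrow> mpoint \<Rightarrow> complex" and \<nu> and x y :: mpoint
    assume \<nu>: "\<nu> > 0" and b: "\<And>x y. cmod (\<psi> x y) \<le> \<nu> * weight_ext g (fst x) * weight_ext g (fst y)"
      and xy: "fst x \<ge> 0" "fst y \<ge> 0"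
    interpret weighted_wave "weight_ext g" \<psi> \<nu> using \<nu> b by (rule wave)
    have "ennreal (cmod (opA1 lam m1 \<psi> x y))
        \<le> ennreal (\<nu> * (lam * m1\<^sup>2 / (16 * pi)) * (fst x + fst y)) * ennreal (g1 (fst x)) * ennreal (g2 (fst y))"
      using norm_opA1_le[of lam m1 x y] lam m xy by (simp only: r1 r2 less_imp_le)
    also have "\<dots> = ennreal (\<nu> * (lam * m1\<^sup>2 / (16 * pi)) * (fst x + fst y) * g1 (fst x) * g2 (fst y))"
      using \<nu> lam xy r1 r2 by (intro ennreal_mult3) auto
    finally show "cmod (opA1 lam m1 \<psi> x y) \<le> \<nu> * (lam * m1\<^sup>2 / (16 * pi) * (fst x + fst y) * g1 (fst x) * g2 (fst y))"
      using \<nu> lam xy r1 r2 by (subst (asm) ennreal_le_iff) (auto simp: mult.assoc)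
  qed (rule R)
  have A2: "opsup g (opA2 lam m2) \<le> ereal (lam * m2\<^sup>2 / (16 * pi)) * R"
  proof (rule opsup_le'[where B="\<lambda>s t. lam * m2\<^sup>2 / (16 * pi) * (t + s) * g1 t * g2 s"])
    show "(\<lambda>p. opA2 lam m2 \<psi> (fst p) (snd p)) \<in> borel_measurable borel" if "\<psi> \<in> schwartz_half" for \<psi>
      by (rule measurable_opA2[OF schwartz_half_measurable[OF that]])
    fix \<psi> :: "mpoint \<Rightarrow> mpoint \<Rightarrow> complex" and \<nu> and x y :: mpoint
    assume \<nu>: "\<nu> > 0" and b: "\<And>x y. cmod (\<psi> x y) \<le> \<nu> * weight_ext g (fst x) * weight_ext g (fst y)"
      and xy: "fst x \<ge> 0" "fst y \<ge> 0"
    interpret weighted_wave "weight_ext g" \<psi> \<nu> using \<nu> b by (rule wave)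
    have "ennreal (cmod (opA2 lam m2 \<psi> x y))
        \<le> ennreal (\<nu> * (lam * m2\<^sup>2 / (16 * pi)) * (fst y + fst x)) * ennreal (g1 (fst y)) * ennreal (g2 (fst x))"
      using norm_opA2_le[of lam m2 x y] lam m xy by (simp only: r1 r2 less_imp_le)
    also have "\<dots> = ennreal (\<nu> * (lam * m2\<^sup>2 / (16 * pi)) * (fst y + fst x) * g1 (fst y) * g2 (fst x))"
      using \<nu> lam xy r1 r2 by (intro ennreal_mult3) auto
    finally show "cmod (opA2 lam m2 \<psi> x y) \<le> \<nu> * (lam * m2\<^sup>2 / (16 * pi) * (fst y + fst x) * g1 (fst y) * g2 (fst x))"
      using \<nu> lam xy r1 r2 by (subst (asm) ennreal_le_iff) (auto simp: mult.assoc)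
  next
    fix s t :: real assume "s \<ge> 0" "t \<ge> 0"
    then show "ereal (lam * m2\<^sup>2 / (16 * pi) * (t + s) * g1 t * g2 s / (g s * g t)) \<le> ereal (lam * m2\<^sup>2 / (16 * pi)) * R"
      using R[of t s m2] by (simp only: mult.commute[of "g s" "g t"])
  qed
  let ?c = "lam * m1\<^sup>2 * m2\<^sup>2 / (96 * pi)"
  let ?T = "tsup (\<lambda>t. t\<^sup>2 * g2 t / g t) * tsup (\<lambda>t. t * g1 t / g t)
             + ereal (1 / 2) * tsup (\<lambda>t. t\<^sup>2 * g3 t / g t) * tsup (\<lambda>t. g1 t / g t)"
  have A12: "opsup g (opA12 lam m1 m2) \<le> ereal ?c * ?T"
  proof (rule opsup_le'[where B="\<lambda>s t. ?c * (s\<^sup>2 * t * g2 s + s\<^sup>2 / 4 * (2 * g3 s)) * g1 t"])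
    show "(\<lambda>p. opA12 lam m1 m2 \<psi> (fst p) (snd p)) \<in> borel_measurable borel" if "\<psi> \<in> schwartz_half" for \<psi>
      by (rule measurable_opA12[OF schwartz_half_measurable[OF that]])
    fix \<psi> :: "mpoint \<Rightarrow> mpoint \<Rightarrow> complex" and \<nu> and x y :: mpoint
    assume \<nu>: "\<nu> > 0" and b: "\<And>x y. cmod (\<psi> x y) \<le> \<nu> * weight_ext g (fst x) * weight_ext g (fst y)"
      and xy: "fst x \<ge> 0" "fst y \<ge> 0"
    interpret weighted_wave "weight_ext g" \<psi> \<nu> using \<nu> b by (rule wave)
    have nn: "\<nu> * ?c \<ge> 0" "(fst x)\<^sup>2 * fst y * g2 (fst x) + (fst x)\<^sup>2 / 4 * (2 * g3 (fst x)) \<ge> 0" "g1 (fst y) \<ge> 0"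
      using \<nu> lam xy r1 r2 r3 by auto
    have "ennreal (cmod (opA12 lam m1 m2 \<psi> x y)) \<le> ennreal (\<nu> * ?c) *
       (ennreal ((fst x)\<^sup>2 * fst y) * ennreal (g2 (fst x)) + ennreal ((fst x)\<^sup>2 / 4) * ennreal (2 * g3 (fst x))) * ennreal (g1 (fst y))"
      using norm_opA12_le[of lam m1 m2 x y] lam m xy by (simp only: r1 r2 r3 less_imp_le)
    also have "\<dots> = ennreal (\<nu> * ?c * ((fst x)\<^sup>2 * fst y * g2 (fst x) + (fst x)\<^sup>2 / 4 * (2 * g3 (fst x)))) * ennreal (g1 (fst y))"
      using \<nu> lam xy r2 r3 by (subst ennreal_lincomb) auto
    also have "\<dots> = ennreal (\<nu> * ?c * ((fst x)\<^sup>2 * fst y * g2 (fst x) + (fst x)\<^sup>2 / 4 * (2 * g3 (fst x))) * g1 (fst y))"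
      using nn by (intro ennreal_mult[symmetric] mult_nonneg_nonneg[OF nn(1)])
    finally have "cmod (opA12 lam m1 m2 \<psi> x y) \<le> \<nu> * ?c * ((fst x)\<^sup>2 * fst y * g2 (fst x) + (fst x)\<^sup>2 / 4 * (2 * g3 (fst x))) * g1 (fst y)"
      using mult_nonneg_nonneg[OF mult_nonneg_nonneg[OF nn(1,2)] nn(3)] by (simp only: ennreal_le_iff)
    then show "cmod (opA12 lam m1 m2 \<psi> x y) \<le> \<nu> * (?c * ((fst x)\<^sup>2 * fst y * g2 (fst x) + (fst x)\<^sup>2 / 4 * (2 * g3 (fst x))) * g1 (fst y))"
      by (simp only: mult.assoc)
  next
    fix s t :: real assume st: "s \<ge> 0" "t \<ge> 0"
    note nn = gp[OF st(1)] gp[OF st(2)] r1(2)[OF st(2)] r2(2)[OF st(1)] r3(2)[OF st(1)] st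
    have 1: "ereal (s\<^sup>2 * g2 s / g s * (t * g1 t / g t)) \<le> tsup (\<lambda>t. t\<^sup>2 * g2 t / g t) * tsup (\<lambda>t. t * g1 t / g t)"
      using nn tsup_mult_ge[of s t "\<lambda>t. t\<^sup>2 * g2 t / g t" "\<lambda>t. t * g1 t / g t"] by auto
    have 2: "ereal (s\<^sup>2 * g3 s / g s * (g1 t / g t)) \<le> tsup (\<lambda>t. t\<^sup>2 * g3 t / g t) * tsup (\<lambda>t. g1 t / g t)"
      using nn tsup_mult_ge[of s t "\<lambda>t. t\<^sup>2 * g3 t / g t" "\<lambda>t. g1 t / g t"] by auto
    \<comment> \<open>Here s^2 / 4 times 2 g3 produces the coefficient 1/2.\<close>
    have "ereal (?c * (s\<^sup>2 * t * g2 s + s\<^sup>2 / 4 * (2 * g3 s)) * g1 t / (g s * g t))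
      = ereal ?c * (ereal (s\<^sup>2 * g2 s / g s * (t * g1 t / g t)) + ereal (1 / 2) * ereal (s\<^sup>2 * g3 s / g s * (g1 t / g t)))"
      using nn by (simp add: field_simps)
    also have "\<dots> \<le> ereal ?c * ?T"
      unfolding mult.assoc[of "ereal (1 / 2)"]
      using lam 1 2 by (intro ereal_mult_left_mono[of _ _ "ereal ?c"] add_mono ereal_mult_left_mono) auto
    finally show "ereal (?c * (s\<^sup>2 * t * g2 s + s\<^sup>2 / 4 * (2 * g3 s)) * g1 t / (g s * g t)) \<le> ereal ?c * ?T" .
  qed
  show ?thesis
    using A0 A1 A2 A12 unfolding R_def g1_def g2_def g3_def by (intro conjI)
qed

end
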